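(* Let $r,n,k\in\mathbb N$ with $r,n\ge 1$ and $k\ge 2$. The following monoids are isomorphic: (i) $\operatorname{tot} nM_{k,r}$; (ii) the endomorphism monoid of an $r$-generated free algebra (that is, the algebra $\mathbb F_{n,k,r}$ freely generated by $r$ elements) in the $n$-dimensional $k$-ary Jónsson–Tarski variety $n\mathcal J_k$.
   Context: Conventions: $\mathbb N=\{0,1,2,\dots\}$. Functions and operations are written on the right of their arguments and composed from left to right; all monoids of maps use this composition. Words and cones. $X_r=\{0,\dots,r-1\}$, $A_k=\{0,\dots,k-1\}$, $A_k^*$ is the set of finite words and $A_k^\omega$ the set of infinite words over $A_k$. Put $nT_{k,r}=X_r\times (A_k^* )^n$, $\mathfrak C_{n,k}=(A_k^\omega)^n$, $\mathfrak C_{n,k,r}=X_r\times\mathfrak C_{n,k}$ (product topology). For $w=(m,s)\in nT_{k,r}$ and $t\in (A_k^* )^n\cup\mathfrak C_{n,k}$, $w\cdot t=(m,st)$, where $st$ is coordinatewise concatenation. For $u,v\in nT_{k,r}$, $u\le v$ means $v=u\cdot t$ for some $t\in(A_k^* )^n$. The cone under $w\in nT_{k,r}$ is $w\mathfrak C_{n,k}=\{w\cdot t: t\in\mathfrak C_{n,k}\}$. For finite $S\subseteq nT_{k,r}$, $\operatorname{Leaves}(S)$ is the set of $\le$-maximal elements of $S$. A pseudotree is a finite subset $T\subseteq nT_{k,r}$ that is downwards closed for $\le$ and such that the cones under the elements of $\operatorname{Leaves}(T)$ partition $\mathfrak C_{n,k,r}$. The monoid $\operatorname{tot} nM_{k,r}$.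 A pseudotree pair is a pair $(D,h)$ with $D$ a pseudotree and $h:\operatorname{Leaves}(D)\to nT_{k,r}$ any function. It represents the map $f:\mathfrak C_{n,k,r}\to\mathfrak C_{n,k,r}$ with $(d\cdot w)f=((d)h)\cdot w$ for all $d\in\operatorname{Leaves}(D)$, $w\in\mathfrak C_{n,k}$. $\operatorname{tot} nM_{k,r}$ is the monoid (under composition) of all maps represented by pseudotree pairs. The variety $n\mathcal J_k$. It consists of the algebras with $k$-ary operations $\lambda_i$ ($i<n$) and unary operations $\alpha_{i,j}$ ($i<n$, $j<k$) satisfying: (i) $(x\alpha_{i,0},\dots,x\alpha_{i,k-1})\lambda_i=x$; (ii) $(x_0,\dots,x_{k-1})\lambda_i\alpha_{i,j}=x_j$; (iii) $x\alpha_{i,j}\alpha_{i',j'}=x\alpha_{i',j'}\alpha_{i,j}$ for $i\ne i'$ in $\{0,\dots,n-1\}$ and $j,j'<k$. *)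

theory Defs
  imports "HOL-Algebra.Group" "HOL-Library.Stream" "HOL-Library.Disjoint_Sets"
    "HOL-Library.FuncSet" "HOL-Library.Countable_Set"
begin

section \<open>Words, cones and pseudotrees\<close>

text \<open>
  An $n$-tuple is an extensional function on \<open>{..<n}\<close>. The infinite words over $A_k$ are the streams
  with entries in \<open>{..<k}\<close>.
\<close>

type_synonym word_tuple = "nat \<Rightarrow> nat list"
type_synonym point = "nat \<Rightarrow> nat stream"

definition words :: "nat \<Rightarrow> nat \<Rightarrow> word_tuple set" where
  "words n k = {..<n} \<rightarrow>\<^sub>E lists {..<k}"

definition cantor :: "nat \<Rightarrow> nat \<Rightarrow> point set" where
  "cantor n k = {..<n} \<rightarrow>\<^sub>E streams {..<k}"

definition nT :: "nat \<Rightarrow> nat \<Rightarrow> nat \<Rightarrow> (nat \<times> word_tuple) set" where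
  "nT n k r = {..<r} \<times> words n k"

definition cantor_r :: "nat \<Rightarrow> nat \<Rightarrow> nat \<Rightarrow> (nat \<times> point) set" where
  "cantor_r n k r = {..<r} \<times> cantor n k"

text \<open>The product $w \cdot t$, for $t$ a tuple of finite words and for $t$ a tuple of infinite words.\<close>

definition word_act :: "nat \<Rightarrow> nat \<times> word_tuple \<Rightarrow> word_tuple \<Rightarrow> nat \<times> word_tuple" where
  "word_act n w t = (fst w, \<lambda>i\<in>{..<n}. snd w i @ t i)"

definition point_act :: "nat \<Rightarrow> nat \<times> word_tuple \<Rightarrow> point \<Rightarrow> nat \<times> point" where
  "point_act n w t = (fst w, \<lambda>i\<in>{..<n}. snd w i @- t i)"

definition nT_le :: "nat \<Rightarrow> nat \<Rightarrow> nat \<times> word_tuple \<Rightarrow> nat \<times> word_tuple \<Rightarrow> bool" where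
  "nT_le n k u v \<longleftrightarrow> (\<exists>t\<in>words n k. v = word_act n u t)"

definition cone :: "nat \<Rightarrow> nat \<Rightarrow> nat \<times> word_tuple \<Rightarrow> (nat \<times> point) set" where
  "cone n k w = point_act n w ` cantor n k"

definition leaves :: "nat \<Rightarrow> nat \<Rightarrow> (nat \<times> word_tuple) set \<Rightarrow> (nat \<times> word_tuple) set" where
  "leaves n k S = {u \<in> S. \<forall>v\<in>S. nT_le n k u v \<longrightarrow> v = u}"

text \<open>
  For $k \ge 2$ distinct elements of $nT_{k,r}$ have distinct cones, so nothing is lost by
  speaking of the set of cones rather than of the family of cones indexed by the leaves.
\<close>

definition pseudotree :: "nat \<Rightarrow> nat \<Rightarrow> nat \<Rightarrow> (nat \<times> word_tuple) set \<Rightarrow> bool" where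
  "pseudotree n k r T \<longleftrightarrow>
     finite T \<and> T \<subseteq> nT n k r \<and>
     (\<forall>v\<in>T. \<forall>u\<in>nT n k r. nT_le n k u v \<longrightarrow> u \<in> T) \<and>
     partition_on (cantor_r n k r) (cone n k ` leaves n k T)"

section \<open>The monoid of maps represented by pseudotree pairs\<close>

definition represents ::
  "nat \<Rightarrow> nat \<Rightarrow> nat \<Rightarrow> (nat \<times> word_tuple) set \<Rightarrow> (nat \<times> word_tuple \<Rightarrow> nat \<times> word_tuple)
    \<Rightarrow> (nat \<times> point \<Rightarrow> nat \<times> point) \<Rightarrow> bool" where
  "represents n k r D h f \<longleftrightarrow>
     pseudotree n k r D \<and> h \<in> leaves n k D \<rightarrow> nT n k r \<and>
     f \<in> cantor_r n k r \<rightarrow>\<^sub>E cantor_r n k r \<and>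
     (\<forall>d\<in>leaves n k D. \<forall>w\<in>cantor n k. f (point_act n d w) = point_act n (h d) w)"

text \<open>
  Maps act on the right: in a product \<open>f \<otimes> g\<close> of maps the factor \<open>f\<close> is applied first.
\<close>

definition tot_nM :: "nat \<Rightarrow> nat \<Rightarrow> nat \<Rightarrow> (nat \<times> point \<Rightarrow> nat \<times> point) monoid" where
  "tot_nM n k r =
     \<lparr>carrier = {f. \<exists>D h. represents n k r D h f},
      mult = (\<lambda>f g. compose (cantor_r n k r) g f),
      one = (\<lambda>x\<in>cantor_r n k r. x)\<rparr>"

section \<open>The variety of n-dimensional k-ary Jonsson-Tarski algebras\<close>

text \<open>The arguments of the \<open>k\<close>-ary operation \<open>lam A i\<close> form a list of length \<open>k\<close>.\<close>

record 'a jt_algebra = "'a partial_object" +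
  lam :: "nat \<Rightarrow> 'a list \<Rightarrow> 'a"
  alpha :: "nat \<Rightarrow> nat \<Rightarrow> 'a \<Rightarrow> 'a"

locale jt_variety =
  fixes n k :: nat and A :: "'a jt_algebra"
  assumes lam_closed:
      "\<lbrakk>i < n; xs \<in> lists (carrier A); length xs = k\<rbrakk> \<Longrightarrow> lam A i xs \<in> carrier A"
    and alpha_closed:
      "\<lbrakk>i < n; j < k; x \<in> carrier A\<rbrakk> \<Longrightarrow> alpha A i j x \<in> carrier A"
    and lam_alpha:
      "\<lbrakk>i < n; x \<in> carrier A\<rbrakk> \<Longrightarrow> lam A i (map (\<lambda>j. alpha A i j x) [0..<k]) = x"
    and alpha_lam:
      "\<lbrakk>i < n; j < k; xs \<in> lists (carrier A); length xs = k\<rbrakk>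
        \<Longrightarrow> alpha A i j (lam A i xs) = xs ! j"
    and alpha_commute:
      "\<lbrakk>i < n; i' < n; i \<noteq> i'; j < k; j' < k; x \<in> carrier A\<rbrakk>
        \<Longrightarrow> alpha A i' j' (alpha A i j x) = alpha A i j (alpha A i' j' x)"

definition jt_hom :: "nat \<Rightarrow> nat \<Rightarrow> 'a jt_algebra \<Rightarrow> 'b jt_algebra \<Rightarrow> ('a \<Rightarrow> 'b) set" where
  "jt_hom n k A B = {h \<in> carrier A \<rightarrow>\<^sub>E carrier B.
     (\<forall>i<n. \<forall>xs\<in>lists (carrier A). length xs = k \<longrightarrow> h (lam A i xs) = lam B i (map h xs)) \<and>
     (\<forall>i<n. \<forall>j<k. \<forall>x\<in>carrier A. h (alpha A i j x) = alpha B i j (h x))}"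

definition jt_End :: "nat \<Rightarrow> nat \<Rightarrow> 'a jt_algebra \<Rightarrow> ('a \<Rightarrow> 'a) monoid" where
  "jt_End n k A =
     \<lparr>carrier = jt_hom n k A A,
      mult = (\<lambda>f g. compose (carrier A) g f),
      one = (\<lambda>x\<in>carrier A. x)\<rparr>"

definition subuniverse :: "nat \<Rightarrow> nat \<Rightarrow> 'a jt_algebra \<Rightarrow> 'a set \<Rightarrow> bool" where
  "subuniverse n k A S \<longleftrightarrow> S \<subseteq> carrier A \<and>
     (\<forall>i<n. \<forall>xs\<in>lists S. length xs = k \<longrightarrow> lam A i xs \<in> S) \<and>
     (\<forall>i<n. \<forall>j<k. \<forall>x\<in>S. alpha A i j x \<in> S)"

definition generates :: "nat \<Rightarrow> nat \<Rightarrow> 'a jt_algebra \<Rightarrow> 'a set \<Rightarrow> bool" where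
  "generates n k A X \<longleftrightarrow> X \<subseteq> carrier A \<and>
     (\<forall>S. subuniverse n k A S \<and> X \<subseteq> S \<longrightarrow> S = carrier A)"

text \<open>
  \<open>A\<close> is freely generated by \<open>X\<close> in the variety: \<open>X\<close> generates \<open>A\<close>, and every map from \<open>X\<close> to a
  member of the variety extends to a homomorphism (necessarily unique, as \<open>X\<close> generates). HOL cannot
  quantify over the type carrying the test algebra \<open>B\<close>, which is fixed here to be \<open>nat\<close>. For countable
  \<open>X\<close> this is no restriction: the images of the elements of \<open>X\<close> generate a countable subalgebra, so
  the extension property follows for test algebras over every type (\<open>freely_generated_extend\<close> below).
\<close>

definition freely_generated :: "nat \<Rightarrow> nat \<Rightarrow> 'a jt_algebra \<Rightarrow> 'a set \<Rightarrow> bool" where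
  "freely_generated n k A X \<longleftrightarrow> jt_variety n k A \<and> generates n k A X \<and>
     (\<forall>(B :: nat jt_algebra) g. jt_variety n k B \<and> g \<in> X \<rightarrow> carrier B \<longrightarrow>
        (\<exists>h\<in>jt_hom n k A B. \<forall>x\<in>X. h x = g x))"

lemma countable_subuniverse:
  fixes B :: "'b jt_algebra"
  assumes B: "jt_variety n k B" and Y: "Y \<subseteq> carrier B" "countable Y"
  obtains S where "Y \<subseteq> S" "countable S" "subuniverse n k B S"
proof -
  define step where "step S = S \<union> (\<Union>i<n. lam B i ` {xs \<in> lists S. length xs = k})
    \<union> (\<Union>i<n. \<Union>j<k. alpha B i j ` S)" for S
  define L where "L m = (step ^^ m) Y" for m
  have L_Suc: "L (Suc m) = step (L m)" for m by (simp add: L_def)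
  have sub: "L m \<subseteq> carrier B" for m
  proof (induction m)
    case (Suc m)
    have "lists (L m) \<subseteq> lists (carrier B)" using Suc by (rule lists_mono)
    with Suc show ?case
      unfolding L_Suc step_def
      by (auto intro!: jt_variety.lam_closed[OF B] jt_variety.alpha_closed[OF B])
  qed (simp add: L_def Y)
  have cnt: "countable (L m)" for m
  proof (induction m)
    case (Suc m)
    have "countable {xs \<in> lists (L m). length xs = k}"
      by (rule countable_subset[OF _ countable_lists[OF Suc]]) auto
    with Suc show ?case unfolding L_Suc step_def by simp
  qed (simp add: L_def Y)
  have mono: "L m \<subseteq> L m'" if "m \<le> m'" for m m'
    using lift_Suc_mono_le[of L, OF _ that] by (auto simp: L_Suc step_def)
  have lst: "\<exists>m. xs \<in> lists (L m)" if "xs \<in> lists (\<Union>m. L m)" for xs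
    using that
  proof (induction xs)
    case (Cons x xs)
    then obtain m m' where "x \<in> L m" "xs \<in> lists (L m')" by auto
    then have "x # xs \<in> lists (L (max m m'))"
      using mono[of m "max m m'"] lists_mono[OF mono[of m' "max m m'"]] by auto
    then show ?case ..
  qed auto
  show thesis
  proof
    show "Y \<subseteq> (\<Union>m. L m)" using UN_upper[of 0 UNIV L] by (simp add: L_def)
    show "countable (\<Union>m. L m)" using cnt by simp
    show "subuniverse n k B (\<Union>m. L m)"
      unfolding subuniverse_def
    proof (intro conjI allI ballI impI)
      show "(\<Union>m. L m) \<subseteq> carrier B" using sub by auto
    next
      fix i xs assume "i < n" "xs \<in> lists (\<Union>m. L m)" "length xs = k"
      moreover then obtain m where "xs \<in> lists (L m)" using lst by blast
      ultimately have "lam B i xs \<in> L (Suc m)" unfolding L_Suc step_def by blast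
      then show "lam B i xs \<in> (\<Union>m. L m)" by blast
    next
      fix i j x assume "i < n" "j < k" "x \<in> (\<Union>m. L m)"
      moreover then obtain m where "x \<in> L m" by blast
      ultimately have "alpha B i j x \<in> L (Suc m)" unfolding L_Suc step_def by blast
      then show "alpha B i j x \<in> (\<Union>m. L m)" by blast
    qed
  qed
qed

lemma freely_generated_extend:
  fixes A :: "'a jt_algebra" and B :: "'b jt_algebra"
  assumes A: "freely_generated n k A X" and X: "countable X"
    and B: "jt_variety n k B" and g: "g \<in> X \<rightarrow> carrier B"
  shows "\<exists>h\<in>jt_hom n k A B. \<forall>x\<in>X. h x = g x"
proof -
  have "g ` X \<subseteq> carrier B" "countable (g ` X)" using g X by auto
  then obtain S where S: "g ` X \<subseteq> S" "countable S" "subuniverse n k B S"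
    by (rule countable_subuniverse[OF B])
  define e where "e = to_nat_on S"
  define d where "d = from_nat_into S"
  have de [simp]: "d (e x) = x" if "x \<in> S" for x
    using that S(2) by (simp add: e_def d_def)
  have SB: "x \<in> carrier B" if "x \<in> S" for x
    using S(3) that by (auto simp: subuniverse_def)
  have Sl: "lam B i xs \<in> S" if "i < n" "xs \<in> lists S" "length xs = k" for i xs
    using S(3) that by (auto simp: subuniverse_def)
  have Sa: "alpha B i j x \<in> S" if "i < n" "j < k" "x \<in> S" for i j x
    using S(3) that by (auto simp: subuniverse_def)
  define N where "N = \<lparr>carrier = e ` S, lam = (\<lambda>i xs. e (lam B i (map d xs))),
    alpha = (\<lambda>i j x. e (alpha B i j (d x)))\<rparr>"
  have N_simps [simp]: "carrier N = e ` S" "lam N i xs = e (lam B i (map d xs))"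
    "alpha N i j x = e (alpha B i j (d x))" for i j xs x
    by (simp_all add: N_def)
  have dl: "map d xs \<in> lists S" if "xs \<in> lists (e ` S)" for xs
    using that by (induction xs) auto
  have SBl: "xs \<in> lists (carrier B)" if "xs \<in> lists S" for xs
    using that SB by auto
  have "jt_variety n k N"
  proof
    fix i xs assume "i < n" "xs \<in> lists (carrier N)" "length xs = k"
    then show "lam N i xs \<in> carrier N" using Sl dl by simp
  next
    fix i j x assume "i < n" "j < k" "x \<in> carrier N"
    then show "alpha N i j x \<in> carrier N" using Sa by auto
  next
    fix i x assume i: "i < n" and "x \<in> carrier N"
    then obtain y where y: "y \<in> S" "x = e y" by auto
    have "map (\<lambda>j. d (e (alpha B i j y))) [0..<k] = map (\<lambda>j. alpha B i j y) [0..<k]"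
      using Sa i y by simp
    then have "lam B i (map (\<lambda>j. d (e (alpha B i j y))) [0..<k]) = y"
      by (simp only: jt_variety.lam_alpha[OF B i SB] y)
    then show "lam N i (map (\<lambda>j. alpha N i j x) [0..<k]) = x"
      using y by (simp add: o_def)
  next
    fix i j xs assume *: "i < n" "j < k" "xs \<in> lists (carrier N)" "length xs = k"
    then have "map d xs \<in> lists S" using dl by simp
    moreover have "e (d (xs ! j)) = xs ! j"
      using * nth_mem[of j xs] by (auto simp del: nth_mem)
    ultimately show "alpha N i j (lam N i xs) = xs ! j"
      using * jt_variety.alpha_lam[OF B *(1,2) SBl, of "map d xs"] Sl by simp
  next
    fix i i' j j' x
    assume *: "i < n" "i' < n" "i \<noteq> i'" "j < k" "j' < k" and "x \<in> carrier N"
    then obtain y where y: "y \<in> S" "x = e y" by auto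
    then show "alpha N i' j' (alpha N i j x) = alpha N i j (alpha N i' j' x)"
      using * Sa jt_variety.alpha_commute[OF B * SB] by simp
  qed
  moreover have "(\<lambda>x. e (g x)) \<in> X \<rightarrow> carrier N" using S(1) by auto
  ultimately obtain h where h: "h \<in> jt_hom n k A N" "\<forall>x\<in>X. h x = e (g x)"
    using A unfolding freely_generated_def by blast
  have hS: "h x \<in> e ` S" if "x \<in> carrier A" for x
    using h(1) that by (auto simp: jt_hom_def)
  have AV: "jt_variety n k A" and XA: "X \<subseteq> carrier A"
    using A by (auto simp: freely_generated_def generates_def)
  have hl: "h (lam A i xs) = e (lam B i (map d (map h xs)))"
    if "i < n" "xs \<in> lists (carrier A)" "length xs = k" for i xs
    using h(1) that by (simp add: jt_hom_def)
  have ha: "h (alpha A i j x) = e (alpha B i j (d (h x)))"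
    if "i < n" "j < k" "x \<in> carrier A" for i j x
    using h(1) that by (simp add: jt_hom_def)
  define f where "f = (\<lambda>x\<in>carrier A. d (h x))"
  have f: "f x = d (h x)" "f x \<in> S" if "x \<in> carrier A" for x
    using hS[OF that] that by (auto simp: f_def)
  have "f \<in> jt_hom n k A B"
    unfolding jt_hom_def
  proof (intro CollectI conjI allI ballI impI)
    show "f \<in> carrier A \<rightarrow>\<^sub>E carrier B" using f SB by (auto simp: f_def)
  next
    fix i xs assume *: "i < n" "xs \<in> lists (carrier A)" "length xs = k"
    have m: "map d (map h xs) = map f xs" using * f by auto
    moreover have "map f xs \<in> lists S" using * f by auto
    ultimately show "f (lam A i xs) = lam B i (map f xs)"
      using * hl[OF *, unfolded m] f(1)[OF jt_variety.lam_closed[OF AV *]] Sl by simp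
  next
    fix i j x assume *: "i < n" "j < k" "x \<in> carrier A"
    then show "f (alpha A i j x) = alpha B i j (f x)"
      using ha[OF *] f(1)[OF jt_variety.alpha_closed[OF AV *]] f Sa by simp
  qed
  moreover have "f x = g x" if "x \<in> X" for x
  proof -
    have "g x \<in> S" "x \<in> carrier A" using that S(1) XA by auto
    then show ?thesis using h(2) that f(1) by simp
  qed
  ultimately show ?thesis by blast
qed

end

theory Submission
  imports Defs
begin

text \<open>
  The maps from $\mathfrak C_{n,k}$ to $\mathfrak C_{n,k,r}$ form a member of the variety, with
  $\alpha_{i,j}$ prepending the letter $j$ to the $i$-th coordinate of the argument. The free
  algebra maps to it by sending the $m$-th generator to $t \mapsto (m,t)$. By the laws of the variety
  an element is determined by its images under all $\alpha_w$ with $w$ of a fixed length in each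
  coordinate; for long $w$ these images have the form $x_m\alpha_u$. Hence the homomorphism
  is injective, and its image consists of the maps that replace prefixes once the
  prefix of the argument is long enough. An endomorphism is given by an $r$-tuple of
  elements of the free algebra, hence by an $r$-tuple of such maps on $\mathfrak C_{n,k}$, which
  is one prefix-replacing map on $\mathfrak C_{n,k,r}$.
\<close>

section \<open>Words acting on algebras\<close>

text \<open>The fold applies the first letter first, in accordance with the right-handed notation,
  where x alpha_{i,j} alpha_{i,j'} is read from left to right.\<close>

definition letters_act :: "'a jt_algebra \<Rightarrow> nat \<Rightarrow> nat list \<Rightarrow> 'a \<Rightarrow> 'a" where
  "letters_act A i = fold (alpha A i)"

text \<open>The number \<open>m\<close> of acting coordinates is a parameter so that proofs can
  induct on it; \<open>m = n\<close> is the action of a whole tuple. In an algebra of the variety,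
  law (iii) makes the order of the coordinates immaterial for words with letters below
  \<open>k\<close>.\<close>

definition tuple_act :: "'a jt_algebra \<Rightarrow> nat \<Rightarrow> word_tuple \<Rightarrow> 'a \<Rightarrow> 'a" where
  "tuple_act A m w = fold (\<lambda>i. letters_act A i (w i)) [0..<m]"

lemma letters_act_simps [simp]:
  "letters_act A i [] x = x"
  "letters_act A i (j # l) x = letters_act A i l (alpha A i j x)"
  by (simp_all add: letters_act_def)

lemma tuple_act_simps [simp]:
  "tuple_act A 0 w x = x"
  "tuple_act A (Suc m) w x = letters_act A m (w m) (tuple_act A m w x)"
  by (simp_all add: tuple_act_def)

lemma tuple_act_cong:
  "(\<And>i. i < m \<Longrightarrow> w i = w' i) \<Longrightarrow> tuple_act A m w x = tuple_act A m w' x"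
  by (induction m) simp_all

lemma words_nth: "w \<in> words n k \<Longrightarrow> i < n \<Longrightarrow> w i \<in> lists {..<k}"
  unfolding words_def by (auto dest: PiE_mem)

lemma words_upd:
  "w \<in> words n k \<Longrightarrow> i < n \<Longrightarrow> l \<in> lists {..<k} \<Longrightarrow> w(i := l) \<in> words n k"
  unfolding words_def by (auto simp: PiE_iff extensional_def)

context jt_variety
begin

lemma letters_act_closed:
  "i < n \<Longrightarrow> l \<in> lists {..<k} \<Longrightarrow> x \<in> carrier A \<Longrightarrow> letters_act A i l x \<in> carrier A"
  by (induction l arbitrary: x) (auto simp: alpha_closed)

lemma tuple_act_closed:
  "m \<le> n \<Longrightarrow> (\<And>i. i < m \<Longrightarrow> w i \<in> lists {..<k}) \<Longrightarrow> x \<in> carrier A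
    \<Longrightarrow> tuple_act A m w x \<in> carrier A"
  by (induction m) (auto simp: letters_act_closed)

lemma alpha_letters_act:
  assumes "i < n" "i' < n" "i \<noteq> i'" "j < k" "l \<in> lists {..<k}" "x \<in> carrier A"
  shows "letters_act A i' l (alpha A i j x) = alpha A i j (letters_act A i' l x)"
  using assms(5,6)
proof (induction l arbitrary: x)
  case (Cons j' l)
  then show ?case
    using assms(1-4) alpha_commute[of i i' j j' x] by (simp add: alpha_closed)
qed simp

lemma alpha_tuple_act_above:
  assumes "m \<le> i" "i < n" "j < k" "\<And>i. i < m \<Longrightarrow> w i \<in> lists {..<k}" "x \<in> carrier A"
  shows "tuple_act A m w (alpha A i j x) = alpha A i j (tuple_act A m w x)"
  using assms
proof (induction m)
  case (Suc m)
  then have "tuple_act A m w x \<in> carrier A" by (intro tuple_act_closed) auto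
  with Suc show ?case by (simp add: alpha_letters_act)
qed simp

text \<open>By law (iii) the coordinates below \<open>i\<close> commute with alpha_{i,j}, which
  makes \<open>j\<close> the first letter that coordinate \<open>i\<close> applies. The coordinates
  above \<open>i\<close> act afterwards, in the same way on both sides.\<close>

lemma tuple_act_alpha_aux:
  assumes "m \<le> n" "i < m" "j < k" "\<And>i. i < m \<Longrightarrow> w i \<in> lists {..<k}" "x \<in> carrier A"
  shows "tuple_act A m w (alpha A i j x) = tuple_act A m (w(i := j # w i)) x"
  using assms
proof (induction m)
  case (Suc m)
  show ?case
  proof (cases "i = m")
    case True
    have eq: "tuple_act A m (w(m := j # w m)) x = tuple_act A m w x"
      by (rule tuple_act_cong) simp
    have "tuple_act A (Suc m) (w(m := j # w m)) x
        = letters_act A m (w m) (alpha A m j (tuple_act A m w x))"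
      by (simp only: tuple_act_simps letters_act_simps fun_upd_same eq)
    moreover have "tuple_act A (Suc m) w (alpha A m j x)
        = letters_act A m (w m) (alpha A m j (tuple_act A m w x))"
      using True Suc.prems by (simp add: alpha_tuple_act_above)
    ultimately show ?thesis by (simp only: True)
  next
    case False
    with Suc show ?thesis by simp
  qed
qed simp

lemma tuple_act_alpha:
  assumes "i < n" "j < k" "w \<in> words n k" "x \<in> carrier A"
  shows "tuple_act A n w (alpha A i j x) = tuple_act A n (w(i := j # w i)) x"
  using assms by (intro tuple_act_alpha_aux) (auto dest: words_nth)

lemma tuple_act_words_closed:
  "w \<in> words n k \<Longrightarrow> x \<in> carrier A \<Longrightarrow> tuple_act A n w x \<in> carrier A"
  by (intro tuple_act_closed) (auto dest: words_nth)

text \<open>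
  The relation \<open>R\<close> serves both to show that elements are equal (\<open>R\<close> is equality) and
  that an element lies in a subuniverse (\<open>R\<close> ignores its second argument).
\<close>

lemma tuple_act_descend:
  assumes R: "\<And>i y z. \<lbrakk>i < n; y \<in> carrier A; z \<in> carrier A;
      \<And>j. j < k \<Longrightarrow> R (alpha A i j y) (alpha A i j z)\<rbrakk> \<Longrightarrow> R y z"
    and yz: "y \<in> carrier A" "z \<in> carrier A"
    and w: "\<And>w. \<lbrakk>w \<in> words n k; \<And>i. i < n \<Longrightarrow> length (w i) = L i\<rbrakk>
      \<Longrightarrow> R (tuple_act A n w y) (tuple_act A n w z)"
  shows "R y z"
  using yz w
\<comment> \<open>Induction on the total length. A step picks a coordinate with
  \<open>L i \<noteq> 0\<close> and passes to the images under alpha_{i,j}, for which the words at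
  \<open>i\<close> are one letter shorter; hence \<open>L\<close>, \<open>y\<close> and
  \<open>z\<close> vary.\<close>
proof (induction "\<Sum>i<n. L i" arbitrary: L y z)
  case 0
  \<comment> \<open>All lengths are 0 here, and the tuple of empty words acts as the
    identity.\<close>
  define e :: word_tuple where "e = (\<lambda>i\<in>{..<n}. [])"
  have "tuple_act A m e x = x" if "m \<le> n" for m x
    using that by (induction m) (simp_all add: e_def)
  moreover have "e \<in> words n k" "\<And>i. i < n \<Longrightarrow> length (e i) = L i"
    using 0(1) by (auto simp: e_def words_def)
  ultimately show ?case using 0(4)[of e] by simp
next
  case (Suc s)
  have "\<exists>i<n. L i \<noteq> 0" using Suc(2) by (metis lessThan_iff nat.distinct(1) sum.neutral)
  then obtain i where i: "i < n" "L i \<noteq> 0" by blast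
  show ?case
  proof (rule R[OF i(1) Suc(3,4)])
    fix j assume j: "j < k"
    show "R (alpha A i j y) (alpha A i j z)"
    proof (rule Suc(1)[of "L(i := L i - 1)"])
      have "(\<Sum>i<n. L i) = L i + (\<Sum>i\<in>{..<n} - {i}. L i)"
        using i by (simp add: sum.remove)
      moreover have "(\<Sum>a<n. (L(i := L i - 1)) a) = L i - 1 + (\<Sum>i\<in>{..<n} - {i}. L i)"
        using i by (simp add: sum.remove[of "{..<n}" i])
      ultimately show "s = (\<Sum>a<n. (L(i := L i - 1)) a)" using i(2) Suc(2) by linarith
    next
      fix w assume w: "w \<in> words n k" "\<And>a. a < n \<Longrightarrow> length (w a) = (L(i := L i - 1)) a"
      have "w(i := j # w i) \<in> words n k"
        using words_upd[OF w(1) i(1)] words_nth[OF w(1) i(1)] j by auto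
      moreover have "length ((w(i := j # w i)) a) = L a" if "a < n" for a
        using w(2)[OF that] i(2) by auto
      ultimately show "R (tuple_act A n w (alpha A i j y)) (tuple_act A n w (alpha A i j z))"
        using Suc(5)[of "w(i := j # w i)"] tuple_act_alpha[OF i(1) j w(1)] Suc(3,4) by simp
    qed (use i j Suc in \<open>auto intro: alpha_closed\<close>)
  qed
qed

text \<open>Law (i) writes an element as lambda_i of its images under alpha_{i,0}, ...,
  alpha_{i,k-1}, so equality of the images passes back to the elements, one letter at a
  time.\<close>

lemma eq_if_tuple_act_eq:
  assumes "y \<in> carrier A" "z \<in> carrier A"
    and "\<And>w. \<lbrakk>w \<in> words n k; \<And>i. i < n \<Longrightarrow> length (w i) = N\<rbrakk>
      \<Longrightarrow> tuple_act A n w y = tuple_act A n w z"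
  shows "y = z"
proof (rule tuple_act_descend[where R = "(=)" and L = "\<lambda>_. N"])
  fix i y z assume *: "i < n" "y \<in> carrier A" "z \<in> carrier A"
    "\<And>j. j < k \<Longrightarrow> alpha A i j y = alpha A i j z"
  then have "map (\<lambda>j. alpha A i j y) [0..<k] = map (\<lambda>j. alpha A i j z) [0..<k]" by simp
  with * show "y = z" by (metis lam_alpha)
qed (use assms in auto)

text \<open>By law (i), lambda_i rebuilds an element from its images under the alpha_{i,j}; when
  these lie in \<open>S\<close>, so does the element.\<close>

lemma subuniverse_if_tuple_act:
  assumes S: "subuniverse n k A S" and "y \<in> carrier A"
    and "\<And>w. \<lbrakk>w \<in> words n k; \<And>i. i < n \<Longrightarrow> length (w i) = N\<rbrakk> \<Longrightarrow> tuple_act A n w y \<in> S"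
  shows "y \<in> S"
proof (rule tuple_act_descend[where R = "\<lambda>y z. y \<in> S" and L = "\<lambda>_. N"])
  fix i y z assume *: "i < n" "y \<in> carrier A" "\<And>j. j < k \<Longrightarrow> alpha A i j y \<in> S"
  then have "map (\<lambda>j. alpha A i j y) [0..<k] \<in> lists S" by auto
  then have "lam A i (map (\<lambda>j. alpha A i j y) [0..<k]) \<in> S"
    using S *(1) unfolding subuniverse_def by simp
  with * show "y \<in> S" by (simp add: lam_alpha)
qed (use assms in auto)

end

section \<open>Homomorphisms and the endomorphism monoid\<close>

lemma generates_eq_carrier:
  "generates n k A X \<Longrightarrow> subuniverse n k A S \<Longrightarrow> X \<subseteq> S \<Longrightarrow> S = carrier A"
  unfolding generates_def by blast

lemma jt_hom_closed: "h \<in> jt_hom n k A B \<Longrightarrow> x \<in> carrier A \<Longrightarrow> h x \<in> carrier B"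
  unfolding jt_hom_def by auto

lemma jt_hom_lam:
  "h \<in> jt_hom n k A B \<Longrightarrow> i < n \<Longrightarrow> xs \<in> lists (carrier A) \<Longrightarrow> length xs = k
    \<Longrightarrow> h (lam A i xs) = lam B i (map h xs)"
  unfolding jt_hom_def by auto

lemma jt_hom_alpha:
  "h \<in> jt_hom n k A B \<Longrightarrow> i < n \<Longrightarrow> j < k \<Longrightarrow> x \<in> carrier A
    \<Longrightarrow> h (alpha A i j x) = alpha B i j (h x)"
  unfolding jt_hom_def by auto

lemma jt_hom_compose:
  assumes f: "f \<in> jt_hom n k A B" and g: "g \<in> jt_hom n k B C" and A: "jt_variety n k A"
  shows "compose (carrier A) g f \<in> jt_hom n k A C"
  unfolding jt_hom_def
proof (intro CollectI conjI allI ballI impI)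
  show "compose (carrier A) g f \<in> carrier A \<rightarrow>\<^sub>E carrier C"
    by (auto simp: compose_def jt_hom_closed[OF f] jt_hom_closed[OF g])
next
  fix i xs assume *: "i < n" "xs \<in> lists (carrier A)" "length xs = k"
  have "map f xs \<in> lists (carrier B)" using * jt_hom_closed[OF f] by auto
  moreover have "map (compose (carrier A) g f) xs = map g (map f xs)"
    using * by (auto simp: compose_def)
  moreover have "compose (carrier A) g f (lam A i xs) = g (lam B i (map f xs))"
    using jt_hom_lam[OF f *] jt_variety.lam_closed[OF A *] by (simp add: compose_def)
  ultimately show
    "compose (carrier A) g f (lam A i xs) = lam C i (map (compose (carrier A) g f) xs)"
    using jt_hom_lam[OF g *(1), of "map f xs"] *(3) by (simp only: length_map)
next
  fix i j x assume *: "i < n" "j < k" "x \<in> carrier A"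
  then show "compose (carrier A) g f (alpha A i j x) = alpha C i j (compose (carrier A) g f x)"
    using jt_variety.alpha_closed[OF A *]
    by (simp add: compose_def jt_hom_alpha[OF f] jt_hom_alpha[OF g] jt_hom_closed[OF f])
qed

lemma jt_hom_tuple_act:
  assumes h: "h \<in> jt_hom n k A B" and A: "jt_variety n k A"
    and w: "w \<in> words n k" and x: "x \<in> carrier A"
  shows "h (tuple_act A n w x) = tuple_act B n w (h x)"
proof -
  have l: "h (letters_act A i l x) = letters_act B i l (h x)"
    if "i < n" "l \<in> lists {..<k}" "x \<in> carrier A" for i l x
    using that
    by (induction l arbitrary: x) (auto simp: jt_hom_alpha[OF h] jt_variety.alpha_closed[OF A])
  have "h (tuple_act A m w x) = tuple_act B m w (h x)" if "m \<le> n" for m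
    using that
  proof (induction m)
    case (Suc m)
    have "tuple_act A m w x \<in> carrier A"
      using Suc.prems x by (intro jt_variety.tuple_act_closed[OF A] words_nth[OF w]) auto
    then show ?case using Suc w by (simp add: l words_nth)
  qed simp
  then show ?thesis by simp
qed

text \<open>The elements on which two homomorphisms agree form a subuniverse. Extensionality turns
  agreement on the carrier into equality of functions.\<close>

lemma jt_hom_eqI:
  assumes gen: "generates n k A X" and A: "jt_variety n k A"
    and f: "f \<in> jt_hom n k A B" and g: "g \<in> jt_hom n k A B"
    and eq: "\<And>x. x \<in> X \<Longrightarrow> f x = g x"
  shows "f = g"
proof -
  define S where "S = {y \<in> carrier A. f y = g y}"
  have "subuniverse n k A S"
    unfolding subuniverse_def
  proof (intro conjI allI ballI impI)
    fix i xs assume *: "i < n" "xs \<in> lists S" "length xs = k"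
    then have xs: "xs \<in> lists (carrier A)" and eq: "map f xs = map g xs" by (auto simp: S_def)
    have "f (lam A i xs) = g (lam A i xs)"
      by (simp only: jt_hom_lam[OF f *(1) xs *(3)] jt_hom_lam[OF g *(1) xs *(3)] eq)
    then show "lam A i xs \<in> S" using jt_variety.lam_closed[OF A *(1) xs *(3)] by (simp add: S_def)
  next
    fix i j x assume "i < n" "j < k" "x \<in> S"
    then show "alpha A i j x \<in> S"
      using jt_variety.alpha_closed[OF A]
      by (simp add: S_def jt_hom_alpha[OF f] jt_hom_alpha[OF g])
  qed (simp add: S_def)
  moreover have "X \<subseteq> S" using gen eq by (auto simp: S_def generates_def)
  ultimately have "S = carrier A" by (intro generates_eq_carrier[OF gen])
  then have "f x = g x" if "x \<in> carrier A" for x using that unfolding S_def by blast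
  moreover have "f \<in> carrier A \<rightarrow>\<^sub>E carrier B" "g \<in> carrier A \<rightarrow>\<^sub>E carrier B"
    using f g by (simp_all add: jt_hom_def)
  ultimately show ?thesis by (intro PiE_ext)
qed

lemma monoid_jt_End:
  assumes A: "jt_variety n k A"
  shows "monoid (jt_End n k A)"
proof (rule monoidI)
  have cl: "h x \<in> carrier A" if "h \<in> jt_hom n k A A" "x \<in> carrier A" for h x
    using that by (rule jt_hom_closed)
  \<comment> \<open>The unit laws are equations between total functions, so values outside the
    carrier matter.\<close>
  have ext: "h \<in> extensional (carrier A)" if "h \<in> jt_hom n k A A" for h
    using that by (auto simp: jt_hom_def PiE_iff)
  show "\<one>\<^bsub>jt_End n k A\<^esub> \<in> carrier (jt_End n k A)"
  proof -
    have "map (\<lambda>x\<in>carrier A. x) xs = xs" if "xs \<in> lists (carrier A)" for xs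
      using that by (induction xs) auto
    then show ?thesis
      using jt_variety.lam_closed[OF A] jt_variety.alpha_closed[OF A]
      by (auto simp: jt_End_def jt_hom_def)
  qed
  fix f g h
  assume f: "f \<in> carrier (jt_End n k A)"
  then have f': "f \<in> jt_hom n k A A" by (simp add: jt_End_def)
  show "\<one>\<^bsub>jt_End n k A\<^esub> \<otimes>\<^bsub>jt_End n k A\<^esub> f = f" "f \<otimes>\<^bsub>jt_End n k A\<^esub> \<one>\<^bsub>jt_End n k A\<^esub> = f"
    using cl[OF f'] ext[OF f'] by (auto simp: jt_End_def compose_def extensional_def)
  assume g: "g \<in> carrier (jt_End n k A)"
  show "f \<otimes>\<^bsub>jt_End n k A\<^esub> g \<in> carrier (jt_End n k A)"
    using f g by (simp add: jt_End_def jt_hom_compose[OF _ _ A])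
  show "f \<otimes>\<^bsub>jt_End n k A\<^esub> g \<otimes>\<^bsub>jt_End n k A\<^esub> h = f \<otimes>\<^bsub>jt_End n k A\<^esub> (g \<otimes>\<^bsub>jt_End n k A\<^esub> h)"
    using cl[OF f'] by (auto simp: jt_End_def compose_def)
qed

section \<open>Concatenation\<close>

text \<open>This and \<open>point_cat\<close> are the second components of \<open>word_act\<close>
  and \<open>point_act\<close>, for tuples that carry no index from X_r.\<close>

abbreviation word_cat :: "nat \<Rightarrow> word_tuple \<Rightarrow> word_tuple \<Rightarrow> word_tuple" where
  "word_cat n w u \<equiv> (\<lambda>i\<in>{..<n}. w i @ u i)"

abbreviation point_cat :: "nat \<Rightarrow> word_tuple \<Rightarrow> point \<Rightarrow> point" where
  "point_cat n w t \<equiv> (\<lambda>i\<in>{..<n}. w i @- t i)"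

lemma cantor_nth: "t \<in> cantor n k \<Longrightarrow> i < n \<Longrightarrow> t i \<in> streams {..<k}"
  unfolding cantor_def by (auto dest: PiE_mem)

lemma shift_in_streams_iff: "l @- s \<in> streams A \<longleftrightarrow> l \<in> lists A \<and> s \<in> streams A"
  by (induction l) (auto simp: streams_Stream)

lemma point_cat_in_cantor: "w \<in> words n k \<Longrightarrow> t \<in> cantor n k \<Longrightarrow> point_cat n w t \<in> cantor n k"
  unfolding cantor_def words_def by (auto simp: PiE_iff shift_in_streams_iff)

lemma word_cat_in_words: "w \<in> words n k \<Longrightarrow> u \<in> words n k \<Longrightarrow> word_cat n w u \<in> words n k"
  unfolding words_def by (auto simp: PiE_iff)

lemma point_act_in_cantor_r: "v \<in> nT n k r \<Longrightarrow> t \<in> cantor n k \<Longrightarrow> point_act n v t \<in> cantor_r n k r"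
  unfolding nT_def cantor_r_def point_act_def by (auto intro: point_cat_in_cantor)

lemma word_act_in_nT: "v \<in> nT n k r \<Longrightarrow> u \<in> words n k \<Longrightarrow> word_act n v u \<in> nT n k r"
  unfolding nT_def word_act_def by (auto intro: word_cat_in_words)

lemma point_act_word_act: "point_act n (word_act n v u) t = point_act n v (point_cat n u t)"
  by (auto simp: point_act_def word_act_def)

lemma sconst_in_cantor: "a < k \<Longrightarrow> (\<lambda>i\<in>{..<n}. sconst a) \<in> cantor n k"
  unfolding cantor_def by (auto intro: sconst_streams)

section \<open>Cancellation and comparison of prefixes\<close>

lemma shift_cancel_right:
  assumes "k \<ge> 2" and "\<And>s. s \<in> streams {..<k::nat} \<Longrightarrow> l @- s = l' @- s"
  shows "l = l'"
  using assms(2)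
proof (induction l l' rule: list_induct2')
  case (2 j l)
  \<comment> \<open>A letter other than \<open>j\<close>, below \<open>k\<close> because k >= 2. Its
    constant stream cannot begin with \<open>j\<close>.\<close>
  define a :: nat where "a = (if j = 0 then 1 else 0)"
  have "sconst a \<in> streams {..<k}" using assms(1) by (auto simp: a_def streams_iff_sset)
  from 2[OF this] have "shd (sconst a) = j" by (metis shift.simps(1,2) stream.sel(1))
  then show ?case by (simp add: a_def split: if_splits)
next
  case (3 j l)
  define a :: nat where "a = (if j = 0 then 1 else 0)"
  have "sconst a \<in> streams {..<k}" using assms(1) by (auto simp: a_def streams_iff_sset)
  from 3[OF this] have "shd (sconst a) = j" by (metis shift.simps(1,2) stream.sel(1))
  then show ?case by (simp add: a_def split: if_splits)
next
  case (4 j l j' l')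
  have "sconst 0 \<in> streams {..<k}" using assms(1) by (auto simp: streams_iff_sset)
  with 4 show ?case by auto
qed simp

text \<open>Points whose coordinates all equal one stream \<open>s\<close> reduce the claim to the
  words in a single coordinate, where \<open>shift_cancel_right\<close> applies.\<close>

lemma point_act_cancel_right:
  assumes k: "k \<ge> 2" and v: "v \<in> nT n k r" "v' \<in> nT n k r"
    and eq: "\<And>t. t \<in> cantor n k \<Longrightarrow> point_act n v t = point_act n v' t"
  shows "v = v'"
proof -
  have "fst v = fst v'"
    using eq[OF sconst_in_cantor[of 0]] k by (simp add: point_act_def)
  moreover have "snd v i = snd v' i" if i: "i < n" for i
  proof (rule shift_cancel_right[OF k])
    fix s assume "s \<in> streams {..<k}"
    then have "(\<lambda>i\<in>{..<n}. s) \<in> cantor n k" by (simp add: cantor_def)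
    from eq[OF this] have "point_cat n (snd v) (\<lambda>i\<in>{..<n}. s) i = point_cat n (snd v') (\<lambda>i\<in>{..<n}. s) i"
      by (simp add: point_act_def)
    then show "snd v i @- s = snd v' i @- s" using i by simp
  qed
  moreover have "snd v \<in> words n k" "snd v' \<in> words n k" using v by (auto simp: nT_def)
  ultimately show ?thesis unfolding words_def
    by (metis PiE_ext lessThan_iff prod.expand)
qed

text \<open>In every coordinate \<open>d\<close> and \<open>v\<close> begin the same stream, and the
  shorter of two beginnings of a stream is a prefix of the longer. Cones that meet are thus nested
  once the lengths compare in the same direction in all coordinates.\<close>

lemma nT_le_of_point_act_eq:
  assumes d: "d \<in> nT n k r" and v: "v \<in> nT n k r"
    and eq: "point_act n d s = point_act n v t"
    and len: "\<And>i. i < n \<Longrightarrow> length (snd d i) \<le> length (snd v i)"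
  shows "nT_le n k d v"
proof -
  define u where "u = (\<lambda>i\<in>{..<n}. drop (length (snd d i)) (snd v i))"
  have w: "snd v \<in> words n k" using v by (auto simp: nT_def)
  then have u: "u \<in> words n k"
    unfolding words_def u_def by (auto simp: PiE_iff dest!: in_set_dropD)
  have eqi: "snd d i @ u i = snd v i" if i: "i < n" for i
  proof -
    have "snd d i @- s i = snd v i @- t i"
      using eq i unfolding point_act_def by (auto dest: fun_cong[of _ _ i])
    then have "stake (length (snd d i)) (snd d i @- s i) = stake (length (snd d i)) (snd v i @- t i)"
      by (rule arg_cong)
    moreover have "stake (length (snd d i)) (snd d i @- s i) = snd d i" by (simp add: stake_shift)
    moreover have "stake (length (snd d i)) (snd v i @- t i) = take (length (snd d i)) (snd v i)"
      using len[OF i] by (simp add: stake_shift)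
    ultimately have "snd d i @ u i = take (length (snd d i)) (snd v i) @ u i" by metis
    also have "\<dots> = snd v i" using i by (simp add: u_def)
    finally show ?thesis .
  qed
  have "word_cat n (snd d) u = snd v"
    using w unfolding words_def
    by (intro PiE_ext[of _ "{..<n}" "\<lambda>_. UNIV"]) (auto simp: eqi PiE_iff)
  moreover have "fst d = fst v" using eq by (simp add: point_act_def)
  ultimately have "v = word_act n d u" by (simp add: word_act_def prod_eq_iff)
  with u show ?thesis unfolding nT_le_def by blast
qed

section \<open>Maps represented by pseudotree pairs\<close>

text \<open>A form of representability in which one bound \<open>N\<close> on the prefix lengths
  takes the place of the tree; \<open>carrier_tot_nM\<close> shows that it captures the
  monoid.\<close>

definition replaces_prefixes ::
  "nat \<Rightarrow> nat \<Rightarrow> nat \<Rightarrow> nat \<Rightarrow> (nat \<times> point \<Rightarrow> nat \<times> point) \<Rightarrow> bool" where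
  "replaces_prefixes n k r N f \<longleftrightarrow> (\<forall>v\<in>nT n k r. (\<forall>i<n. N \<le> length (snd v i)) \<longrightarrow>
     (\<exists>v'\<in>nT n k r. \<forall>t\<in>cantor n k. f (point_act n v t) = point_act n v' t))"

text \<open>If \<open>v\<close> is at least as long as all words in \<open>D\<close>, its cone meets
  the cone of some leaf \<open>d\<close>, and by length \<open>d\<close> is a prefix of
  \<open>v\<close>. Writing v = d u, the map replaces the prefix \<open>v\<close> by (h d)
  u.\<close>

lemma represents_imp_replaces_prefixes:
  assumes k: "k \<ge> 2" and rep: "represents n k r D h f"
  shows "\<exists>N. replaces_prefixes n k r N f"
proof -
  have D: "finite D" "D \<subseteq> nT n k r"
    and P: "partition_on (cantor_r n k r) (cone n k ` leaves n k D)"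
    using rep by (auto simp: represents_def pseudotree_def)
  \<comment> \<open>The inserted 0 keeps the set nonempty, whatever \<open>D\<close> and
    \<open>n\<close> are.\<close>
  define N where "N = Max (insert 0 ((\<lambda>(d, i). length (snd d i)) ` (D \<times> {..<n})))"
  have N: "length (snd d i) \<le> N" if "d \<in> D" "i < n" for d i
    unfolding N_def using that D(1) by (intro Max_ge) auto
  have "\<exists>v'\<in>nT n k r. \<forall>t\<in>cantor n k. f (point_act n v t) = point_act n v' t"
    if v: "v \<in> nT n k r" "\<forall>i<n. N \<le> length (snd v i)" for v
  proof -
    \<comment> \<open>One point of the cone of \<open>v\<close> is enough to find the leaf.\<close>
    have "(\<lambda>i\<in>{..<n}. sconst 0) \<in> cantor n k" using k by (intro sconst_in_cantor) simp
    then have "point_act n v (\<lambda>i\<in>{..<n}. sconst 0) \<in> \<Union> (cone n k ` leaves n k D)"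
      using point_act_in_cantor_r[OF v(1)] P by (simp add: partition_on_def)
    then obtain d s where d: "d \<in> leaves n k D"
      and s: "point_act n d s = point_act n v (\<lambda>i\<in>{..<n}. sconst 0)"
      by (auto simp: cone_def)
    have dD: "d \<in> D" using d by (simp add: leaves_def)
    have "nT_le n k d v"
    proof (rule nT_le_of_point_act_eq[OF _ v(1) s])
      show "d \<in> nT n k r" using dD D by blast
      show "length (snd d i) \<le> length (snd v i)" if "i < n" for i
        using N[OF dD that] v(2) that by (meson le_trans)
    qed
    then obtain u where u: "u \<in> words n k" "v = word_act n d u" by (auto simp: nT_le_def)
    have "h d \<in> nT n k r" using rep d by (auto simp: represents_def)
    moreover have "f (point_act n v t) = point_act n (word_act n (h d) u) t"
      if "t \<in> cantor n k" for t
      using rep d point_cat_in_cantor[OF u(1) that]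
      by (simp add: represents_def u(2) point_act_word_act)
    ultimately show ?thesis using u(1) by (blast intro: word_act_in_nT)
  qed
  then show ?thesis unfolding replaces_prefixes_def by blast
qed

section \<open>Pseudotrees of uniform depth\<close>

definition uniform_tree :: "nat \<Rightarrow> nat \<Rightarrow> nat \<Rightarrow> nat \<Rightarrow> (nat \<times> word_tuple) set" where
  "uniform_tree n k r N = {v \<in> nT n k r. \<forall>i<n. length (snd v i) \<le> N}"

text \<open>Short words can be padded to length \<open>N\<close> inside the tree, so a maximal tuple
  has none. A tuple whose words all have length \<open>N\<close> extends inside the tree only by
  empty words.\<close>

lemma leaves_uniform_tree:
  assumes k: "k \<ge> 1"
  shows "leaves n k (uniform_tree n k r N) = {v \<in> nT n k r. \<forall>i<n. length (snd v i) = N}"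
proof (intro Set.set_eqI iffI)
  fix v assume "v \<in> leaves n k (uniform_tree n k r N)"
  then have v: "v \<in> nT n k r" "\<forall>i<n. length (snd v i) \<le> N"
    and mx: "\<And>u. u \<in> uniform_tree n k r N \<Longrightarrow> nT_le n k v u \<Longrightarrow> u = v"
    by (auto simp: leaves_def uniform_tree_def)
  \<comment> \<open>Padding by the letter 0, which exists since k >= 1, brings every coordinate to
    length exactly \<open>N\<close>.\<close>
  define p where "p = (\<lambda>i\<in>{..<n}. replicate (N - length (snd v i)) (0::nat))"
  have p: "p \<in> words n k" using k by (auto simp: words_def p_def)
  have "word_act n v p \<in> uniform_tree n k r N"
    using v(2) word_act_in_nT[OF v(1) p] by (auto simp: uniform_tree_def word_act_def p_def)
  moreover have "nT_le n k v (word_act n v p)" using p by (auto simp: nT_le_def)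
  ultimately have "word_act n v p = v" by (rule mx)
  moreover have "length (snd (word_act n v p) i) = N" if "i < n" for i
    using that v(2) by (simp add: word_act_def p_def)
  ultimately show "v \<in> {v \<in> nT n k r. \<forall>i<n. length (snd v i) = N}" using v(1) by simp
next
  fix v assume v: "v \<in> {v \<in> nT n k r. \<forall>i<n. length (snd v i) = N}"
  have "u = v" if u: "u \<in> uniform_tree n k r N" "nT_le n k v u" for u
  proof -
    obtain t where t: "t \<in> words n k" "u = word_act n v t" using u(2) by (auto simp: nT_le_def)
    have "t i = []" if "i < n" for i
    proof -
      have "length (snd u i) \<le> N" using u(1) that by (simp add: uniform_tree_def)
      then show ?thesis using v t(2) that by (simp add: word_act_def)
    qed
    moreover have "snd v \<in> words n k" using v by (auto simp: nT_def)
    ultimately have "word_cat n (snd v) t = snd v"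
      by (auto simp: words_def PiE_iff extensional_def)
    then show ?thesis by (simp add: t(2) word_act_def)
  qed
  then show "v \<in> leaves n k (uniform_tree n k r N)"
    using v by (auto simp: leaves_def uniform_tree_def)
qed

text \<open>Every coordinate is cut after \<open>N\<close> letters. This is why the cones of uniform
  depth cover the space.\<close>

lemma cantor_r_split:
  assumes "x \<in> cantor_r n k r"
  obtains v t where "v \<in> nT n k r" "t \<in> cantor n k" "\<And>i. i < n \<Longrightarrow> length (snd v i) = N"
    "x = point_act n v t"
proof -
  obtain m s where x: "x = (m, s)" "m < r" "s \<in> cantor n k" using assms by (auto simp: cantor_r_def)
  have st: "stake N (s i) \<in> lists {..<k}" "sdrop N (s i) \<in> streams {..<k}" if "i < n" for i
    using cantor_nth[OF x(3) that] shift_in_streams_iff[of "stake N (s i)" "sdrop N (s i)" "{..<k}"]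
    by (simp_all add: stake_sdrop)
  show thesis
  proof
    show "(m, \<lambda>i\<in>{..<n}. stake N (s i)) \<in> nT n k r"
      using x(2) st by (auto simp: nT_def words_def)
    show "(\<lambda>i\<in>{..<n}. sdrop N (s i)) \<in> cantor n k" using st by (auto simp: cantor_def)
    show "x = point_act n (m, \<lambda>i\<in>{..<n}. stake N (s i)) (\<lambda>i\<in>{..<n}. sdrop N (s i))"
      using x(1,3) by (auto simp: point_act_def cantor_def PiE_iff extensional_def stake_sdrop)
  qed simp
qed

lemma pseudotree_uniform_tree:
  assumes k: "k \<ge> 1"
  shows "pseudotree n k r (uniform_tree n k r N)"
  unfolding pseudotree_def
proof (intro conjI ballI impI)
  show "finite (uniform_tree n k r N)"
  proof (rule finite_subset)
    show "uniform_tree n k r N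
        \<subseteq> {..<r} \<times> ({..<n} \<rightarrow>\<^sub>E {l. set l \<subseteq> {..<k} \<and> length l \<le> N})"
      by (auto simp: uniform_tree_def nT_def words_def PiE_iff)
    show "finite ({..<r} \<times> ({..<n} \<rightarrow>\<^sub>E {l. set l \<subseteq> {..<k} \<and> length l \<le> N}))"
      by (intro finite_cartesian_product finite_PiE finite_lists_length_le) auto
  qed
  show "uniform_tree n k r N \<subseteq> nT n k r" by (auto simp: uniform_tree_def)
  show "u \<in> uniform_tree n k r N"
    if "v \<in> uniform_tree n k r N" "u \<in> nT n k r" "nT_le n k u v" for u v
    using that by (auto simp: uniform_tree_def nT_le_def word_act_def)
  show "partition_on (cantor_r n k r) (cone n k ` leaves n k (uniform_tree n k r N))"
    unfolding leaves_uniform_tree[OF k]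
  proof (rule partition_onI)
    show "{} \<notin> cone n k ` {v \<in> nT n k r. \<forall>i<n. length (snd v i) = N}"
      using sconst_in_cantor[of 0 k n] k by (auto simp: cone_def)
  next
    show "\<Union> (cone n k ` {v \<in> nT n k r. \<forall>i<n. length (snd v i) = N}) = cantor_r n k r"
      by (auto simp: cone_def point_act_in_cantor_r elim!: cantor_r_split[where N = N])
  next
    fix p q assume "p \<in> cone n k ` {v \<in> nT n k r. \<forall>i<n. length (snd v i) = N}"
      "q \<in> cone n k ` {v \<in> nT n k r. \<forall>i<n. length (snd v i) = N}" "p \<noteq> q"
    then obtain v u where v: "v \<in> nT n k r" "\<forall>i<n. length (snd v i) = N" "p = cone n k v"
      and u: "u \<in> nT n k r" "\<forall>i<n. length (snd u i) = N" "q = cone n k u" by auto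
    show "disjnt p q"
    proof (rule ccontr)
      assume "\<not> disjnt p q"
      then obtain y where "y \<in> cone n k v" "y \<in> cone n k u"
        by (auto simp: disjnt_def v(3) u(3))
      then obtain s t where eq: "point_act n v s = point_act n u t"
        unfolding cone_def by (metis imageE)
      \<comment> \<open>Equal lengths and a common point make \<open>v\<close> a prefix of
        \<open>u\<close>; maximality of \<open>v\<close> then gives \<open>u = v\<close>.\<close>
      have "nT_le n k v u" using nT_le_of_point_act_eq[OF v(1) u(1) eq] v(2) u(2) by simp
      moreover have "v \<in> leaves n k (uniform_tree n k r N)" "u \<in> uniform_tree n k r N"
        using v u by (simp_all add: leaves_uniform_tree[OF k]) (simp add: uniform_tree_def)
      ultimately have "u = v" by (auto simp: leaves_def)
      with \<open>p \<noteq> q\<close> v(3) u(3) show False by simp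
    qed
  qed
qed

text \<open>In one direction \<open>N\<close> comes from the longest word in a pseudotree. In the
  other, the uniform tree of depth \<open>N\<close> serves, since its leaves are long enough for the
  bound, and \<open>h\<close> is chosen leaf by leaf.\<close>

lemma carrier_tot_nM:
  assumes k: "k \<ge> 2"
  shows "carrier (tot_nM n k r)
    = {f \<in> cantor_r n k r \<rightarrow>\<^sub>E cantor_r n k r. \<exists>N. replaces_prefixes n k r N f}"
proof (intro Set.set_eqI iffI)
  fix f assume "f \<in> carrier (tot_nM n k r)"
  then obtain D h where "represents n k r D h f" by (auto simp: tot_nM_def)
  then show "f \<in> {f \<in> cantor_r n k r \<rightarrow>\<^sub>E cantor_r n k r. \<exists>N. replaces_prefixes n k r N f}"
    using represents_imp_replaces_prefixes[OF k] by (auto simp: represents_def)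
next
  fix f assume "f \<in> {f \<in> cantor_r n k r \<rightarrow>\<^sub>E cantor_r n k r. \<exists>N. replaces_prefixes n k r N f}"
  then obtain N where f: "f \<in> cantor_r n k r \<rightarrow>\<^sub>E cantor_r n k r" "replaces_prefixes n k r N f" by auto
  have "\<forall>v\<in>leaves n k (uniform_tree n k r N).
      \<exists>v'\<in>nT n k r. \<forall>t\<in>cantor n k. f (point_act n v t) = point_act n v' t"
    using f(2) k by (auto simp: leaves_uniform_tree replaces_prefixes_def)
  then obtain h where "\<forall>v\<in>leaves n k (uniform_tree n k r N). h v \<in> nT n k r \<and>
      (\<forall>t\<in>cantor n k. f (point_act n v t) = point_act n (h v) t)"
    by metis
  then have "represents n k r (uniform_tree n k r N) h f"
    using f(1) k by (auto simp: represents_def pseudotree_uniform_tree)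
  then show "f \<in> carrier (tot_nM n k r)" by (auto simp: tot_nM_def)
qed

section \<open>The algebra of maps on the Cantor space\<close>

text \<open>In \<open>lam\<close> the first letter of coordinate \<open>i\<close> selects the map
  that is applied to the rest. This undoes the prepending done by \<open>alpha\<close>, whence laws
  (i) and (ii); prepending in distinct coordinates commutes, whence law (iii). The restrictions keep
  the maps extensional.\<close>

definition map_algebra :: "nat \<Rightarrow> nat \<Rightarrow> 'b set \<Rightarrow> (point \<Rightarrow> 'b) jt_algebra" where
  "map_algebra n k Y = \<lparr>carrier = cantor n k \<rightarrow>\<^sub>E Y,
     lam = (\<lambda>i ps. \<lambda>t\<in>cantor n k. (ps ! shd (t i)) (t(i := stl (t i)))),
     alpha = (\<lambda>i j p. \<lambda>t\<in>cantor n k. p (t(i := j ## t i)))\<rparr>"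

lemma map_algebra_simps [simp]:
  "carrier (map_algebra n k Y) = cantor n k \<rightarrow>\<^sub>E Y"
  "lam (map_algebra n k Y) i ps = (\<lambda>t\<in>cantor n k. (ps ! shd (t i)) (t(i := stl (t i))))"
  "alpha (map_algebra n k Y) i j p = (\<lambda>t\<in>cantor n k. p (t(i := j ## t i)))"
  by (simp_all add: map_algebra_def)

lemma cantor_upd: "t \<in> cantor n k \<Longrightarrow> i < n \<Longrightarrow> s \<in> streams {..<k} \<Longrightarrow> t(i := s) \<in> cantor n k"
  unfolding cantor_def by (auto simp: PiE_iff extensional_def)

lemma cantor_shd: "t \<in> cantor n k \<Longrightarrow> i < n \<Longrightarrow> shd (t i) < k"
  by (drule (1) cantor_nth) (metis lessThan_iff streams_shd)

lemma cantor_stl: "t \<in> cantor n k \<Longrightarrow> i < n \<Longrightarrow> t(i := stl (t i)) \<in> cantor n k"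
  by (meson cantor_nth cantor_upd streams_stl)

lemma cantor_Stream: "t \<in> cantor n k \<Longrightarrow> i < n \<Longrightarrow> j < k \<Longrightarrow> t(i := j ## t i) \<in> cantor n k"
  by (simp add: cantor_nth cantor_upd streams_Stream)

lemma jt_variety_map_algebra: "jt_variety n k (map_algebra n k Y)"
proof
  fix i ps assume *: "i < n" "ps \<in> lists (carrier (map_algebra n k Y))" "length ps = k"
  have "(ps ! shd (t i)) (t(i := stl (t i))) \<in> Y" if t: "t \<in> cantor n k" for t
  proof -
    have "ps ! shd (t i) \<in> cantor n k \<rightarrow>\<^sub>E Y"
      using * cantor_shd[OF t *(1)] nth_mem by fastforce
    then show ?thesis using cantor_stl[OF t *(1)] by auto
  qed
  then show "lam (map_algebra n k Y) i ps \<in> carrier (map_algebra n k Y)" by simp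
next
  fix i j p assume "i < n" "j < k" "p \<in> carrier (map_algebra n k Y)"
  then show "alpha (map_algebra n k Y) i j p \<in> carrier (map_algebra n k Y)"
    by (auto intro: cantor_Stream)
next
  fix i p assume *: "i < n" "p \<in> carrier (map_algebra n k Y)"
  then show "lam (map_algebra n k Y) i (map (\<lambda>j. alpha (map_algebra n k Y) i j p) [0..<k]) = p"
    by (auto simp: cantor_shd cantor_stl PiE_iff extensional_def)
next
  fix i j ps
  assume *: "i < n" "j < k" "ps \<in> lists (carrier (map_algebra n k Y))" "length ps = k"
  then have "ps ! j \<in> cantor n k \<rightarrow>\<^sub>E Y" using nth_mem by fastforce
  moreover have "alpha (map_algebra n k Y) i j (lam (map_algebra n k Y) i ps)
      = (\<lambda>t\<in>cantor n k. (ps ! j) t)"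
    unfolding map_algebra_simps using *(1,2) by (intro restrict_ext) (simp add: cantor_Stream)
  ultimately show "alpha (map_algebra n k Y) i j (lam (map_algebra n k Y) i ps) = ps ! j"
    by (simp only: PiE_restrict)
next
  fix i i' j j' p assume "i < n" "i' < n" "i \<noteq> i'" "j < k" "j' < k"
  then show "alpha (map_algebra n k Y) i' j' (alpha (map_algebra n k Y) i j p)
      = alpha (map_algebra n k Y) i j (alpha (map_algebra n k Y) i' j' p)"
    by (auto simp: cantor_Stream fun_upd_twist)
qed

text \<open>The operation applied last is the first to prepend its letter, so \<open>l\<close>
  stands in front of the argument in its own order.\<close>

lemma letters_act_map_algebra:
  assumes "i < n" "l \<in> lists {..<k}" "t \<in> cantor n k"
  shows "letters_act (map_algebra n k Y) i l p t = p (t(i := l @- t i))"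
  using assms(2)
proof (induction l arbitrary: p)
  case (Cons j l)
  then have "t(i := l @- t i) \<in> cantor n k"
    using assms by (intro cantor_upd) (auto simp: shift_in_streams_iff cantor_nth)
  then have "alpha (map_algebra n k Y) i j p (t(i := l @- t i)) = p (t(i := (j # l) @- t i))"
    by simp
  moreover have "letters_act (map_algebra n k Y) i l (alpha (map_algebra n k Y) i j p) t
      = alpha (map_algebra n k Y) i j p (t(i := l @- t i))"
    by (rule Cons.IH)
  ultimately show ?case by (simp only: letters_act_simps)
qed simp

lemma tuple_act_map_algebra:
  assumes w: "w \<in> words n k" and t: "t \<in> cantor n k"
  shows "tuple_act (map_algebra n k Y) n w p t = p (point_cat n w t)"
proof -
  \<comment> \<open>Here the first \<open>m\<close> coordinates act. The point varies in the
    induction because coordinate \<open>m\<close> extends it before the lower coordinates are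
    evaluated.\<close>
  have "tuple_act (map_algebra n k Y) m w p t
      = p (\<lambda>i\<in>{..<n}. if i < m then w i @- t i else t i)" if "m \<le> n" for m
    using that t
  proof (induction m arbitrary: t)
    case 0
    then have "(\<lambda>i\<in>{..<n}. t i) = t" by (auto simp: cantor_def PiE_iff extensional_def)
    then show ?case by simp
  next
    case (Suc m)
    have m: "m < n" "w m \<in> lists {..<k}" using Suc.prems words_nth[OF w] by auto
    then have t': "t(m := w m @- t m) \<in> cantor n k"
      using Suc.prems by (intro cantor_upd) (auto simp: shift_in_streams_iff cantor_nth)
    have eq: "(\<lambda>i\<in>{..<n}. if i < m then w i @- (t(m := w m @- t m)) i else (t(m := w m @- t m)) i)
        = (\<lambda>i\<in>{..<n}. if i < Suc m then w i @- t i else t i)"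
      by (auto simp: less_Suc_eq)
    have "tuple_act (map_algebra n k Y) m w p (t(m := w m @- t m))
        = p (\<lambda>i\<in>{..<n}. if i < Suc m then w i @- t i else t i)"
      unfolding eq[symmetric] by (rule Suc.IH[OF _ t']) (use Suc.prems in simp)
    then show ?case
      by (simp only: tuple_act_simps letters_act_map_algebra[OF m Suc.prems(2)])
  qed
  then show ?thesis
    by (simp cong: restrict_cong)
qed

section \<open>The free algebra as an algebra of maps\<close>

text \<open>\<open>x\<close> enumerates the generators and \<open>h\<close> is the homomorphism into
  the algebra of maps that freeness provides. Freeness enters once more as the assumption
  \<open>ext\<close> of \<open>induced_map_surj\<close>.\<close>

locale jt_coordinates = jt_variety n k F
  for n k and F :: "'a jt_algebra" (structure) +
  fixes r :: nat and x :: "nat \<Rightarrow> 'a" and h :: "'a \<Rightarrow> point \<Rightarrow> nat \<times> point"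
  assumes k: "k \<ge> 2"
    and gen: "generates n k F (x ` {..<r})"
    and h: "h \<in> jt_hom n k F (map_algebra n k (cantor_r n k r))"
    and h_gen: "\<And>m t. m < r \<Longrightarrow> t \<in> cantor n k \<Longrightarrow> h (x m) t = (m, t)"
begin

section \<open>Injectivity and image of the homomorphism \<open>h\<close>\<close>

lemma x_closed: "m < r \<Longrightarrow> x m \<in> carrier F"
  using gen by (auto simp: generates_def)

lemma h_closed: "y \<in> carrier F \<Longrightarrow> h y \<in> cantor n k \<rightarrow>\<^sub>E cantor_r n k r"
  using jt_hom_closed[OF h] by simp

lemma h_tuple_act:
  assumes "w \<in> words n k" "y \<in> carrier F" "t \<in> cantor n k"
  shows "h (tuple_act F n w y) t = h y (point_cat n w t)"
  using assms by (simp add: jt_hom_tuple_act[OF h jt_variety_axioms] tuple_act_map_algebra)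

lemma h_tuple_act_gen:
  assumes "v \<in> nT n k r" "t \<in> cantor n k"
  shows "h (tuple_act F n (snd v) (x (fst v))) t = point_act n v t"
  using assms
  by (auto simp: nT_def h_tuple_act x_closed h_gen point_cat_in_cantor point_act_def)

text \<open>The algebraic counterpart of \<open>replaces_prefixes\<close>. The length is bounded
  below rather than fixed, so that finitely many elements have a common \<open>N\<close>.\<close>

definition eventually_gen :: "nat \<Rightarrow> 'a \<Rightarrow> bool" where
  "eventually_gen N y \<longleftrightarrow> (\<forall>w\<in>words n k. (\<forall>i<n. N \<le> length (w i)) \<longrightarrow>
     (\<exists>v\<in>nT n k r. tuple_act F n w y = tuple_act F n (snd v) (x (fst v))))"

lemma eventually_gen_mono: "eventually_gen N y \<Longrightarrow> N \<le> N' \<Longrightarrow> eventually_gen N' y"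
  unfolding eventually_gen_def by (meson le_trans)

lemma ex_eventually_gen_finite:
  assumes "finite S" "\<And>y. y \<in> S \<Longrightarrow> \<exists>N. eventually_gen N y"
  shows "\<exists>N. \<forall>y\<in>S. eventually_gen N y"
proof -
  obtain N where N: "\<And>y. y \<in> S \<Longrightarrow> eventually_gen (N y) y" using assms(2) by metis
  have "eventually_gen (Max (N ` S)) y" if "y \<in> S" for y
    by (rule eventually_gen_mono[OF N[OF that]]) (simp add: assms(1) that)
  then show ?thesis by blast
qed

text \<open>The elements that have such a bound form a subuniverse, and the generators have the
  bound 0.\<close>

lemma ex_eventually_gen:
  assumes "y \<in> carrier F"
  shows "\<exists>N. eventually_gen N y"
proof -
  define S where "S = {y \<in> carrier F. \<exists>N. eventually_gen N y}"
  have "subuniverse n k F S"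
    unfolding subuniverse_def
  proof (intro conjI allI ballI impI)
    fix i ys assume *: "i < n" "ys \<in> lists S" "length ys = k"
    have ys: "ys \<in> lists (carrier F)" using *(2) by (auto simp: S_def)
    have "\<exists>N. eventually_gen N y" if "y \<in> set ys" for y
      using *(2) that by (auto simp: S_def)
    then obtain N where N: "\<forall>y\<in>set ys. eventually_gen N y"
      using ex_eventually_gen_finite[of "set ys"] by blast
    \<comment> \<open>One letter more than for the arguments: by law (ii) the first letter in
      coordinate \<open>i\<close> is spent on selecting an argument.\<close>
    have "eventually_gen (Suc N) (lam F i ys)"
      unfolding eventually_gen_def
    proof (intro ballI impI)
      fix w assume w: "w \<in> words n k" "\<forall>i<n. Suc N \<le> length (w i)"
      obtain j l where jl: "w i = j # l" using w(2) *(1) by (metis Suc_le_length_iff)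
      have j: "j < k" "l \<in> lists {..<k}" using words_nth[OF w(1) *(1)] jl by auto
      have w': "w(i := l) \<in> words n k" using words_upd[OF w(1) *(1) j(2)] .
      have eq: "(w(i := l))(i := j # (w(i := l)) i) = w" using jl by auto
      have "tuple_act F n w (lam F i ys) = tuple_act F n (w(i := l)) (alpha F i j (lam F i ys))"
        using tuple_act_alpha[OF *(1) j(1) w' lam_closed[OF *(1) ys *(3)]] unfolding eq by simp
      also have "\<dots> = tuple_act F n (w(i := l)) (ys ! j)"
        using alpha_lam[OF *(1) j(1) ys *(3)] by simp
      moreover have "eventually_gen N (ys ! j)" using N *(3) j(1) by simp
      moreover have "\<forall>a<n. N \<le> length ((w(i := l)) a)" using w(2) jl *(1) by auto
      ultimately show "\<exists>v\<in>nT n k r. tuple_act F n w (lam F i ys) = tuple_act F n (snd v) (x (fst v))"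
        using w' unfolding eventually_gen_def by metis
    qed
    then show "lam F i ys \<in> S" using lam_closed[OF *(1) ys *(3)] by (auto simp: S_def)
  next
    fix i j y assume *: "i < n" "j < k" "y \<in> S"
    then obtain N where N: "eventually_gen N y" and y: "y \<in> carrier F" by (auto simp: S_def)
    have "eventually_gen N (alpha F i j y)"
      unfolding eventually_gen_def
    proof (intro ballI impI)
      fix w assume w: "w \<in> words n k" "\<forall>i<n. N \<le> length (w i)"
      have "w(i := j # w i) \<in> words n k"
        using words_upd[OF w(1) *(1)] words_nth[OF w(1) *(1)] *(2) by simp
      \<comment> \<open>The extra letter \<open>j\<close> only lengthens the word, so the bound of
        \<open>y\<close> serves unchanged.\<close>
      moreover have "\<forall>a<n. N \<le> length ((w(i := j # w i)) a)" using w(2) by (auto simp: le_SucI)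
      ultimately show "\<exists>v\<in>nT n k r. tuple_act F n w (alpha F i j y) = tuple_act F n (snd v) (x (fst v))"
        using N tuple_act_alpha[OF *(1,2) w(1) y] unfolding eventually_gen_def by simp
    qed
    then show "alpha F i j y \<in> S" using alpha_closed[OF *(1,2) y] by (auto simp: S_def)
  qed (simp add: S_def)
  moreover have "x m \<in> S" if "m < r" for m
  proof -
    have "eventually_gen 0 (x m)"
      unfolding eventually_gen_def
    proof (intro ballI impI)
      fix w assume "w \<in> words n k"
      then show "\<exists>v\<in>nT n k r. tuple_act F n w (x m) = tuple_act F n (snd v) (x (fst v))"
        using that by (intro bexI[of _ "(m, w)"]) (simp_all add: nT_def)
    qed
    then show ?thesis using x_closed[OF that] by (auto simp: S_def)
  qed
  ultimately have "S = carrier F" by (intro generates_eq_carrier[OF gen]) auto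
  then show ?thesis using assms unfolding S_def by blast
qed

text \<open>For words of a common large length, both elements are carried to some x_m alpha_u and
  x_m' alpha_u'. Their images under \<open>h\<close> are the maps that prepend (m,u) and (m',u').
  These maps coincide, so the prefixes do, and \<open>eq_if_tuple_act_eq\<close> descends to the
  elements.\<close>

lemma h_inj: "inj_on h (carrier F)"
proof
  fix y z assume y: "y \<in> carrier F" and z: "z \<in> carrier F" and eq: "h y = h z"
  have "\<exists>N. eventually_gen N u" if "u \<in> {y, z}" for u
    using that y z ex_eventually_gen by blast
  then obtain N where N: "\<forall>u\<in>{y, z}. eventually_gen N u"
    using ex_eventually_gen_finite[of "{y, z}"] by blast
  show "y = z"
  proof (rule eq_if_tuple_act_eq[OF y z, of N])
    fix w assume w: "w \<in> words n k" "\<And>i. i < n \<Longrightarrow> length (w i) = N"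
    have ex: "\<exists>v\<in>nT n k r. tuple_act F n w u = tuple_act F n (snd v) (x (fst v))"
      if "u \<in> {y, z}" for u
      using bspec[OF N that] w unfolding eventually_gen_def by simp
    obtain v where v: "v \<in> nT n k r" "tuple_act F n w y = tuple_act F n (snd v) (x (fst v))"
      using ex[of y] by auto
    obtain v' where v': "v' \<in> nT n k r" "tuple_act F n w z = tuple_act F n (snd v') (x (fst v'))"
      using ex[of z] by auto
    have "v = v'"
    proof (rule point_act_cancel_right[OF k v(1) v'(1)])
      fix t assume t: "t \<in> cantor n k"
      have "point_act n v t = h (tuple_act F n w y) t" using h_tuple_act_gen[OF v(1) t] v(2) by simp
      also have "\<dots> = h (tuple_act F n w z) t" using h_tuple_act w(1) y z t eq by simp
      also have "\<dots> = point_act n v' t" using h_tuple_act_gen[OF v'(1) t] v'(2) by simp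
      finally show "point_act n v t = point_act n v' t" .
    qed
    then show "tuple_act F n w y = tuple_act F n w z" using v(2) v'(2) by simp
  qed
qed

lemma subuniverse_h_image: "subuniverse n k (map_algebra n k (cantor_r n k r)) (h ` carrier F)"
  unfolding subuniverse_def
proof (intro conjI allI ballI impI)
  show "h ` carrier F \<subseteq> carrier (map_algebra n k (cantor_r n k r))" using jt_hom_closed[OF h] by blast
next
  fix i ps assume *: "i < n" "ps \<in> lists (h ` carrier F)" "length ps = k"
  then obtain ys where ys: "ys \<in> lists (carrier F)" "ps = map h ys"
    unfolding lists_image by (elim imageE)
  then have len: "length ys = k" using *(3) by simp
  have "lam (map_algebra n k (cantor_r n k r)) i ps = h (lam F i ys)"
    unfolding ys(2) by (rule jt_hom_lam[OF h *(1) ys(1) len, symmetric])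
  then show "lam (map_algebra n k (cantor_r n k r)) i ps \<in> h ` carrier F"
    using lam_closed[OF *(1) ys(1) len] by (rule image_eqI)
next
  fix i j p assume *: "i < n" "j < k" "p \<in> h ` carrier F"
  obtain y where y: "p = h y" "y \<in> carrier F" using *(3) by (rule imageE)
  have "alpha (map_algebra n k (cantor_r n k r)) i j p = h (alpha F i j y)"
    unfolding y(1) by (rule jt_hom_alpha[OF h *(1,2) y(2), symmetric])
  then show "alpha (map_algebra n k (cantor_r n k r)) i j p \<in> h ` carrier F"
    using alpha_closed[OF *(1,2) y(2)] by (rule image_eqI)
qed

text \<open>Acting by words of length \<open>N\<close> turns \<open>p\<close> into maps that merely
  prepend some (m,u); each is the image of x_m alpha_u. The image of \<open>h\<close> is a
  subuniverse, so law (i) brings \<open>p\<close> into it.\<close>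

lemma h_surj:
  assumes p: "p \<in> cantor n k \<rightarrow>\<^sub>E cantor_r n k r"
    and N: "\<And>w. \<lbrakk>w \<in> words n k; \<And>i. i < n \<Longrightarrow> length (w i) = N\<rbrakk>
      \<Longrightarrow> \<exists>v\<in>nT n k r. \<forall>t\<in>cantor n k. p (point_cat n w t) = point_act n v t"
  shows "p \<in> h ` carrier F"
proof (rule jt_variety.subuniverse_if_tuple_act[OF jt_variety_map_algebra subuniverse_h_image, of _ N])
  show "p \<in> carrier (map_algebra n k (cantor_r n k r))" using p by simp
  fix w assume w: "w \<in> words n k" "\<And>i. i < n \<Longrightarrow> length (w i) = N"
  obtain v where v: "v \<in> nT n k r" "\<forall>t\<in>cantor n k. p (point_cat n w t) = point_act n v t"
    using N[OF w] by auto
  define y where "y = tuple_act F n (snd v) (x (fst v))"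
  have y: "y \<in> carrier F"
    using v(1) by (auto simp: y_def nT_def x_closed intro: tuple_act_words_closed)
  have eq: "tuple_act (map_algebra n k (cantor_r n k r)) n w p = h y"
  proof (rule PiE_ext)
    show "tuple_act (map_algebra n k (cantor_r n k r)) n w p \<in> cantor n k \<rightarrow>\<^sub>E cantor_r n k r"
      using jt_variety.tuple_act_words_closed[OF jt_variety_map_algebra w(1)] p
      unfolding map_algebra_simps(1)[symmetric] .
    show "h y \<in> cantor n k \<rightarrow>\<^sub>E cantor_r n k r" using h_closed[OF y] .
    fix t assume t: "t \<in> cantor n k"
    show "tuple_act (map_algebra n k (cantor_r n k r)) n w p t = h y t"
      unfolding y_def tuple_act_map_algebra[OF w(1) t] h_tuple_act_gen[OF v(1) t]
      using v(2) t by blast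
  qed
  show "tuple_act (map_algebra n k (cantor_r n k r)) n w p \<in> h ` carrier F"
    unfolding eq using y by (rule imageI)
qed

section \<open>The map on the Cantor space induced by an endomorphism\<close>

definition induced_map :: "('a \<Rightarrow> 'a) \<Rightarrow> nat \<times> point \<Rightarrow> nat \<times> point" where
  "induced_map \<phi> = (\<lambda>(m, t)\<in>cantor_r n k r. h (\<phi> (x m)) t)"

lemma induced_map_apply:
  "m < r \<Longrightarrow> t \<in> cantor n k \<Longrightarrow> induced_map \<phi> (m, t) = h (\<phi> (x m)) t"
  by (simp add: induced_map_def cantor_r_def)

lemma induced_map_extensional: "induced_map \<phi> \<in> extensional (cantor_r n k r)"
  by (simp add: induced_map_def)

text \<open>On generators this is the definition of \<open>induced_map\<close>, because h(x_m) takes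
  the value (m,t) at t. The operations on maps alter only the argument and the choice of map, so
  they commute with applying a fixed map to the values; hence the elements in question form a
  subuniverse.\<close>

lemma h_endomorphism:
  assumes \<phi>: "\<phi> \<in> jt_hom n k F F" and y: "y \<in> carrier F" and t: "t \<in> cantor n k"
  shows "h (\<phi> y) t = induced_map \<phi> (h y t)"
proof -
  define S where "S = {y \<in> carrier F. \<forall>t\<in>cantor n k. h (\<phi> y) t = induced_map \<phi> (h y t)}"
  have "subuniverse n k F S"
    unfolding subuniverse_def
  proof (intro conjI allI ballI impI)
    fix i ys assume *: "i < n" "ys \<in> lists S" "length ys = k"
    then have ys: "ys \<in> lists (carrier F)" by (auto simp: S_def)
    then have \<phi>ys: "map \<phi> ys \<in> lists (carrier F)" using jt_hom_closed[OF \<phi>] by auto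
    have "h (\<phi> (lam F i ys)) t = induced_map \<phi> (h (lam F i ys) t)" if t: "t \<in> cantor n k" for t
    proof -
      \<comment> \<open>At \<open>t\<close> only the argument selected by the first letter of
        coordinate \<open>i\<close> is evaluated.\<close>
      have s: "shd (t i) < length ys" using cantor_shd[OF t *(1)] *(3) by simp
      then have "ys ! shd (t i) \<in> S" using *(2) by (auto dest: nth_mem)
      then show ?thesis
        using t s * ys \<phi>ys cantor_stl[OF t *(1)]
        by (simp add: jt_hom_lam[OF \<phi>] jt_hom_lam[OF h] S_def)
    qed
    then show "lam F i ys \<in> S" using lam_closed[OF *(1) ys *(3)] by (simp add: S_def)
  next
    fix i j y assume *: "i < n" "j < k" "y \<in> S"
    then show "alpha F i j y \<in> S"
      by (simp add: S_def alpha_closed jt_hom_alpha[OF \<phi>] jt_hom_alpha[OF h]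
          jt_hom_closed[OF \<phi>] cantor_Stream)
  qed (simp add: S_def)
  moreover have "x ` {..<r} \<subseteq> S"
    by (auto simp: S_def x_closed h_gen induced_map_apply)
  ultimately have "S = carrier F" by (intro generates_eq_carrier[OF gen])
  with y t show ?thesis unfolding S_def by blast
qed

text \<open>The finitely many elements \<phi>(x_m) have a common bound for
  \<open>eventually_gen\<close>, and \<open>h\<close> turns it into a bound for
  \<open>replaces_prefixes\<close>.\<close>

lemma induced_map_closed:
  assumes \<phi>: "\<phi> \<in> jt_hom n k F F"
  shows "induced_map \<phi> \<in> carrier (tot_nM n k r)"
proof -
  have \<phi>x: "\<phi> (x m) \<in> carrier F" if "m < r" for m
    using jt_hom_closed[OF \<phi> x_closed[OF that]] .
  then have "\<exists>N. eventually_gen N y" if "y \<in> (\<lambda>m. \<phi> (x m)) ` {..<r}" for y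
    using that ex_eventually_gen by blast
  then obtain N where N: "\<forall>y\<in>(\<lambda>m. \<phi> (x m)) ` {..<r}. eventually_gen N y"
    using ex_eventually_gen_finite[of "(\<lambda>m. \<phi> (x m)) ` {..<r}"] by blast
  have "replaces_prefixes n k r N (induced_map \<phi>)"
    unfolding replaces_prefixes_def
  proof (intro ballI impI)
    fix v assume v: "v \<in> nT n k r" "\<forall>i<n. N \<le> length (snd v i)"
    then have m: "fst v < r" and w: "snd v \<in> words n k" by (auto simp: nT_def)
    obtain v' where v': "v' \<in> nT n k r"
      "tuple_act F n (snd v) (\<phi> (x (fst v))) = tuple_act F n (snd v') (x (fst v'))"
      using N m w v(2) unfolding eventually_gen_def by blast
    have "induced_map \<phi> (point_act n v t) = point_act n v' t" if t: "t \<in> cantor n k" for t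
    proof -
      have "induced_map \<phi> (point_act n v t) = h (\<phi> (x (fst v))) (point_cat n (snd v) t)"
        unfolding point_act_def using induced_map_apply[OF m point_cat_in_cantor[OF w t]] .
      also have "\<dots> = h (tuple_act F n (snd v) (\<phi> (x (fst v)))) t"
        using h_tuple_act[OF w \<phi>x[OF m] t] by simp
      also have "\<dots> = point_act n v' t" using h_tuple_act_gen[OF v'(1) t] v'(2) by simp
      finally show ?thesis .
    qed
    then show "\<exists>v'\<in>nT n k r. \<forall>t\<in>cantor n k. induced_map \<phi> (point_act n v t) = point_act n v' t"
      using v'(1) by blast
  qed
  moreover have "induced_map \<phi> \<in> cantor_r n k r \<rightarrow>\<^sub>E cantor_r n k r"
    using h_closed[OF \<phi>x] unfolding induced_map_def by (auto simp: cantor_r_def dest!: PiE_mem)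
  ultimately show ?thesis unfolding carrier_tot_nM[OF k] by blast
qed

text \<open>The composite is evaluated at (m,t) by \<open>h_endomorphism\<close> for \<psi> at the
  element \<phi>(x_m). Both monoids apply the left factor first, so the order of factors is
  preserved.\<close>

lemma induced_map_hom: "induced_map \<in> hom (jt_End n k F) (tot_nM n k r)"
proof (rule homI)
  fix \<phi> \<psi> assume "\<phi> \<in> carrier (jt_End n k F)" "\<psi> \<in> carrier (jt_End n k F)"
  then have \<phi>: "\<phi> \<in> jt_hom n k F F" and \<psi>: "\<psi> \<in> jt_hom n k F F" by (simp_all add: jt_End_def)
  have "induced_map (compose (carrier F) \<psi> \<phi>) (m, t) = induced_map \<psi> (induced_map \<phi> (m, t))"
    if "m < r" "t \<in> cantor n k" for m t
    using that h_endomorphism[OF \<psi> jt_hom_closed[OF \<phi> x_closed[OF that(1)]] that(2)]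
    by (simp add: induced_map_apply compose_def x_closed)
  then have "induced_map (compose (carrier F) \<psi> \<phi>)
      = compose (cantor_r n k r) (induced_map \<psi>) (induced_map \<phi>)"
    by (intro extensionalityI[OF induced_map_extensional])
      (auto simp: compose_def[of "{..<r} \<times> cantor n k"] cantor_r_def)
  then show "induced_map (\<phi> \<otimes>\<^bsub>jt_End n k F\<^esub> \<psi>)
      = induced_map \<phi> \<otimes>\<^bsub>tot_nM n k r\<^esub> induced_map \<psi>"
    by (simp add: jt_End_def tot_nM_def)
qed (simp add: jt_End_def induced_map_closed)

lemma induced_map_one: "induced_map \<one>\<^bsub>jt_End n k F\<^esub> = \<one>\<^bsub>tot_nM n k r\<^esub>"
  unfolding induced_map_def
  by (auto simp: jt_End_def tot_nM_def cantor_r_def x_closed h_gen intro!: restrict_ext)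

text \<open>The induced map determines every h(\<phi>(x_m)), hence \<phi>(x_m) by injectivity of
  \<open>h\<close>, hence \<phi> since the x_m generate.\<close>

lemma induced_map_inj: "inj_on induced_map (carrier (jt_End n k F))"
proof
  fix \<phi> \<psi> assume "\<phi> \<in> carrier (jt_End n k F)" "\<psi> \<in> carrier (jt_End n k F)"
  then have \<phi>: "\<phi> \<in> jt_hom n k F F" and \<psi>: "\<psi> \<in> jt_hom n k F F" by (simp_all add: jt_End_def)
  assume eq: "induced_map \<phi> = induced_map \<psi>"
  show "\<phi> = \<psi>"
  proof (rule jt_hom_eqI[OF gen jt_variety_axioms \<phi> \<psi>])
    fix y assume "y \<in> x ` {..<r}"
    then obtain m where m: "m < r" "y = x m" by auto
    have cl: "\<phi> y \<in> carrier F" "\<psi> y \<in> carrier F"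
      using jt_hom_closed[OF \<phi>] jt_hom_closed[OF \<psi>] x_closed m by auto
    have "h (\<phi> y) = h (\<psi> y)"
    proof (rule PiE_ext[OF h_closed h_closed])
      show "h (\<phi> y) t = h (\<psi> y) t" if "t \<in> cantor n k" for t
        using that eq m induced_map_apply[of m t \<phi>] induced_map_apply[of m t \<psi>] by simp
    qed (use cl in auto)
    then show "\<phi> y = \<psi> y" using h_inj cl by (auto dest: inj_onD)
  qed
qed

text \<open>By \<open>h_surj\<close> each slice t -> f(m,t) is the image under \<open>h\<close> of
  some element; sending x_m to it defines an endomorphism that induces \<open>f\<close>.\<close>

lemma induced_map_surj:
  assumes ext: "\<And>g. g \<in> {..<r} \<rightarrow> carrier F \<Longrightarrow> \<exists>\<phi>\<in>jt_hom n k F F. \<forall>m<r. \<phi> (x m) = g m"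
    and f: "f \<in> carrier (tot_nM n k r)"
  shows "f \<in> induced_map ` carrier (jt_End n k F)"
proof -
  obtain N where fE: "f \<in> cantor_r n k r \<rightarrow>\<^sub>E cantor_r n k r" and N: "replaces_prefixes n k r N f"
    using f unfolding carrier_tot_nM[OF k] by blast
  have "\<exists>y\<in>carrier F. \<forall>t\<in>cantor n k. h y t = f (m, t)" if m: "m < r" for m
  proof -
    let ?p = "\<lambda>t\<in>cantor n k. f (m, t)"
    have "?p \<in> h ` carrier F"
    proof (rule h_surj)
      show "(\<lambda>t\<in>cantor n k. f (m, t)) \<in> cantor n k \<rightarrow>\<^sub>E cantor_r n k r"
        using fE m by (auto simp: cantor_r_def)
    next
      fix w assume w: "w \<in> words n k" "\<And>i. i < n \<Longrightarrow> length (w i) = N"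
      have "(m, w) \<in> nT n k r" using m w(1) by (simp add: nT_def)
      then have "\<exists>v\<in>nT n k r. \<forall>t\<in>cantor n k. f (point_act n (m, w) t) = point_act n v t"
        using N w(2) unfolding replaces_prefixes_def by simp
      then show "\<exists>v\<in>nT n k r. \<forall>t\<in>cantor n k.
          (\<lambda>t\<in>cantor n k. f (m, t)) (point_cat n w t) = point_act n v t"
        using point_cat_in_cantor[OF w(1)] by (simp add: point_act_def[of n "(m, w)"])
    qed
    then obtain y where y: "y \<in> carrier F" "?p = h y" by (rule imageE)
    have "h y t = f (m, t)" if "t \<in> cantor n k" for t unfolding y(2)[symmetric] using that by simp
    with y(1) show ?thesis by blast
  qed
  then obtain g where g: "\<And>m. m < r \<Longrightarrow> g m \<in> carrier F \<and> (\<forall>t\<in>cantor n k. h (g m) t = f (m, t))"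
    by metis
  then obtain \<phi> where \<phi>: "\<phi> \<in> jt_hom n k F F" "\<forall>m<r. \<phi> (x m) = g m" using ext[of g] by auto
  have "f = induced_map \<phi>"
    using fE \<phi>(2) g
    by (intro extensionalityI[of _ "cantor_r n k r"])
      (auto simp: induced_map_def cantor_r_def PiE_iff)
  moreover have "\<phi> \<in> carrier (jt_End n k F)" using \<phi>(1) by (simp add: jt_End_def)
  ultimately show ?thesis by (rule image_eqI)
qed

end

section \<open>Inverse isomorphism and conclusion\<close>

lemma (in monoid) iso_sym_monoid:
  assumes "f \<in> iso G H"
  shows "H \<cong> G"
proof (rule is_isoI)
  let ?g = "inv_into (carrier G) f"
  have f: "f \<in> hom G H" "bij_betw f (carrier G) (carrier H)" using assms by (auto simp: iso_def)
  have g: "bij_betw ?g (carrier H) (carrier G)" using f(2) by (rule bij_betw_inv_into)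
  have "?g (a \<otimes>\<^bsub>H\<^esub> b) = ?g a \<otimes> ?g b" if "a \<in> carrier H" "b \<in> carrier H" for a b
  \<comment> \<open>As \<open>f\<close> is injective, it suffices that \<open>f\<close> sends the
    product of the two preimages to the given product.\<close>
  proof (rule inv_into_f_eq)
    show "inj_on f (carrier G)" using f(2) by (rule bij_betw_imp_inj_on)
    show "?g a \<otimes> ?g b \<in> carrier G" using bij_betwE[OF g] that by simp
    show "f (?g a \<otimes> ?g b) = a \<otimes>\<^bsub>H\<^esub> b"
      using hom_mult[OF f(1)] bij_betwE[OF g] bij_betw_inv_into_right[OF f(2)] that by simp
  qed
  then show "?g \<in> iso H G" using g bij_betwE[OF g] by (auto simp: iso_def hom_def)
qed

theorem theorem1p1:
  fixes r n k :: nat and F :: "'a jt_algebra" and X :: "'a set"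
  assumes "r \<ge> 1" and "n \<ge> 1" and "k \<ge> 2"
    and "freely_generated n k F X" and "card X = r"
  shows "monoid (tot_nM n k r) \<and> monoid (jt_End n k F) \<and> tot_nM n k r \<cong> jt_End n k F"
proof -
  \<comment> \<open>An infinite set has \<open>card\<close> 0, which r >= 1 excludes.\<close>
  have fin: "finite X" using assms(1,5) card.infinite by fastforce
  obtain x where x: "bij_betw x {..<r} X"
    using ex_bij_betw_nat_finite[OF fin] assms(5) by (auto simp: lessThan_atLeast0)
  have F: "jt_variety n k F" and gen: "generates n k F X"
    using assms(4) by (auto simp: freely_generated_def)
  \<comment> \<open>The extension property in terms of indices. It is applied to the algebra of
    maps, to obtain \<open>h\<close>, and to \<open>F\<close> itself, to obtain
    endomorphisms.\<close>
  have ext: "\<exists>\<phi>\<in>jt_hom n k F B. \<forall>m<r. \<phi> (x m) = g m"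
    if B: "jt_variety n k B" and g: "g \<in> {..<r} \<rightarrow> carrier B" for g and B :: "'b jt_algebra"
  proof -
    have inv: "the_inv_into {..<r} x (x m) = m" if "m < r" for m
      using x that by (simp add: bij_betw_def the_inv_into_f_f)
    have "(\<lambda>y. g (the_inv_into {..<r} x y)) \<in> X \<rightarrow> carrier B"
      using g x inv by (auto simp: bij_betw_def)
    from freely_generated_extend[OF assms(4) countable_finite[OF fin] B this]
    obtain \<phi> where \<phi>: "\<phi> \<in> jt_hom n k F B" "\<forall>y\<in>X. \<phi> y = g (the_inv_into {..<r} x y)" ..
    then have "\<forall>m<r. \<phi> (x m) = g m" using inv bij_betwE[OF x] by simp
    with \<phi>(1) show ?thesis by blast
  qed
  have "(\<lambda>m. \<lambda>t\<in>cantor n k. (m, t)) \<in> {..<r} \<rightarrow> carrier (map_algebra n k (cantor_r n k r))"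
    by (auto simp: cantor_r_def)
  from ext[OF jt_variety_map_algebra this]
  obtain h where h: "h \<in> jt_hom n k F (map_algebra n k (cantor_r n k r))"
    "\<forall>m<r. h (x m) = (\<lambda>t\<in>cantor n k. (m, t))" by blast
  interpret jt_coordinates n k F r x h
    using F assms(3) gen h bij_betw_imp_surj_on[OF x]
    by (auto simp: jt_coordinates_def jt_coordinates_axioms_def)
  interpret E: monoid "jt_End n k F" using F by (rule monoid_jt_End)
  have im: "induced_map ` carrier (jt_End n k F) = carrier (tot_nM n k r)"
    using induced_map_hom induced_map_surj[OF ext[OF F]] by (auto simp: hom_def)
  \<comment> \<open>The homomorphic image of a monoid is a monoid, and this image is all of
    \<open>tot_nM n k r\<close>; closure under composition comes from here.\<close>
  have "monoid (tot_nM n k r)"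
    using E.hom_imp_img_monoid[OF induced_map_hom] by (simp add: im induced_map_one)
  moreover have "induced_map \<in> iso (jt_End n k F) (tot_nM n k r)"
    using induced_map_hom induced_map_inj im by (auto simp: iso_def bij_betw_def)
  ultimately show ?thesis
    using E.monoid_axioms E.iso_sym_monoid by blast
qed

end
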